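(* Let $\lambda>0$, $f\in C_b(X)$ and let $u=R(\lambda,L)f$, that is $u(x)=\int_0^\infty e^{-\lambda t}P_tf(x)\,dt$. The following statements hold. (i) If $1/\theta\notin\mathbb{N}$, then $u\in C^{1/\theta}_H(X)$, and there exists $C=C(\lambda)>0$, independent of $f$, such that $\|u\|_{C^{1/\theta}_H(X)}\le C\|f\|_\infty$. (ii) If $\alpha\in(0,1)$ with $\alpha+1/\theta\notin\mathbb{N}$ and $f\in C^\alpha_H(X)$, then $u\in C^{\alpha+1/\theta}_H(X)$, and there exists $C=C(\lambda,\alpha)>0$, independent of $f$, such that $\|u\|_{C^{\alpha+1/\theta}_H(X)}\le C\|f\|_{C^\alpha_H(X)}$.
   Context: Setting. $X$ is a real separable Banach space; for Banach spaces, $H\subset X$ means that $H$ is contained in $X$ with continuous embedding. $C_b(X)$ is the space of bounded continuous functions $X\to\mathbb{R}$ with the sup norm $\|\cdot\|_\infty$. $(T_t)_{t\ge0}$ is a strongly continuous semigroup of bounded linear operators on $X$, and $(\mu_t)_{t\ge0}$ are Borel probability measures on $X$ with $\mu_0=\delta_0$, $t\mapsto\mu_t$ weakly continuous on $[0,\infty)$, and $\mu_{t+s}=(\mu_t\circ T_s^{-1})*\mu_s$ for $t,s>0$. The generalized Mehler semigroup is $P_tf(x)=\int_Xf(T_tx+y)\,\mu_t(dy)$, $t\ge0$. Its generator $L$ is the unique closed operator in $C_b(X)$ whose resolvent is $R(\lambda,L)f(x)=\int_0^\infty e^{-\lambda t}P_tf(x)\,dt$, $\lambda>0$, $f\in C_b(X)$,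 $x\in X$. Fomin differentiability. A Borel probability measure $\mu$ on $X$ is Fomin differentiable along $v\in X$ if $\lim_{t\to0}(\mu(A+tv)-\mu(A))/t$ exists and is finite for every Borel set $A$. The limit is then a signed measure $d_v\mu$, absolutely continuous with respect to $\mu$, with density $\beta^\mu_v\in L^1(X,\mu)$. Equivalently, there is $\beta^\mu_v\in L^1(X,\mu)$ with $\int_X\frac{\partial f}{\partial v}\,d\mu=-\int_X\beta^\mu_vf\,d\mu$ for all $f\in C^1_b(X)$. Standing hypotheses. (1) For every $t>0$ there is a subspace $\{0\}\ne H_t\subset X$ such that $\mu_t$ is Fomin differentiable along every $h\in H_t$. (2) There exist a Banach space $H\subset X$ and constants $M,C,\theta>0$, $\omega\in\mathbb{R}$ such that for all $t>0$, $h\in H$: $T_t(H)\subset H$ and $\|T_th\|_H\le Me^{\omega t}\|h\|_H$; $T_t(H)\subset H_t$ and $\|\beta^{\mu_t}_{T_th}\|_{L^1(X,\mu_t)}\le Ce^{\omega t}t^{-\theta}\|h\|_H$. Function spaces. For a Banach space $Y$, $F:X\to Y$ is $H$-Gateaux differentiable at $x$ if $\partial F/\partial h(x)=\lim_{t\to0}(F(x+th)-F(x))/t$ exists for all $h\in H$ and $D_HF(x):h\mapsto\partial F/\partial h(x)$ belongs to $\mathcal{L}(H,Y)$. $\mathcal{L}^n(H)$ is the space of continuous $n$-linear maps $H^n\to\mathbb{R}$ with norm $\|T\|=\sup\{|T(h_1,\dots,h_n)|/(\|h_1\|_H\cdots\|h_n\|_H):h_i\in H\setminus\{0\}\}$,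 identified with $\mathcal{L}(H,\mathcal{L}^{n-1}(H))$; $D^n_Hf(x)\in\mathcal{L}^n(H)$ is the $H$-Gateaux derivative at $x$ of $D^{n-1}_Hf:X\to\mathcal{L}^{n-1}(H)$. $C^n_H(X)$ ($n\in\mathbb{N}=\{1,2,\dots\}$) is the set of $f\in C_b(X)$ having $H$-Gateaux derivatives up to order $n$ at every point such that $x\mapsto D^k_Hf(x)(h_1,\dots,h_k)$ is continuous and bounded for all $k\le n$ and $h_i\in H$, with norm $\|f\|_\infty+\sum_{k=1}^n\sup_x\|D^k_Hf(x)\|_{\mathcal{L}^k(H)}$. For $\sigma\in(0,1)$ and $F:X\to Y$, $[F]_{C^\sigma_H(X,Y)}=\sup_{x\in X,h\in H\setminus\{0\}}\|F(x+h)-F(x)\|_Y/\|h\|_H^\sigma$. $C^\sigma_H(X)=\{f\in C_b(X):[f]_{C^\sigma_H(X)}<\infty\}$ with norm $\|f\|_\infty+[f]_{C^\sigma_H(X)}$. For $n\in\mathbb{N}$, $C^{\sigma+n}_H(X)=\{f\in C^n_H(X):[D^n_Hf]_{C^\sigma_H(X,\mathcal{L}^n(H))}<\infty\}$ with norm $\|f\|_{C^n_H(X)}+[D^n_Hf]_{C^\sigma_H(X,\mathcal{L}^n(H))}$. *)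

theory Defs
  imports "HOL-Probability.Probability"
begin

text \<open>
  The Banach space \<open>X\<close> is a type \<open>'a\<close> of class \<open>banach\<close> and \<open>second_countable_topology\<close> (for a
  metric space, separability). A Banach space \<open>H\<close> continuously embedded in \<open>X\<close> is a type
  \<open>'h :: banach\<close> together with an injective bounded linear map \<open>i :: 'h \<Rightarrow>\<^sub>L 'a\<close>, so that the norm
  of \<open>'h\<close> is the norm of \<open>H\<close>. The space of bounded continuous functions on \<open>X\<close> is the library set
  \<open>bcontfun\<close>.
\<close>

section \<open>Generalized Mehler semigroups\<close>

definition strongly_continuous_semigroup :: "(real \<Rightarrow> 'a::real_normed_vector \<Rightarrow>\<^sub>L 'a) \<Rightarrow> bool" where
  "strongly_continuous_semigroup T \<longleftrightarrow>
     T 0 = id_blinfun \<and>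
     (\<forall>s\<ge>0. \<forall>t\<ge>0. T (s + t) = T s o\<^sub>L T t) \<and>
     (\<forall>x. continuous_on {0..} (\<lambda>t. T t x))"

text \<open>
  The library's \<open>convolution\<close> is restricted to finite-dimensional spaces, so the convolution of two
  measures is written out here as the image of the product measure under addition.
\<close>

definition mehler_measures ::
  "(real \<Rightarrow> 'a::{banach, second_countable_topology} \<Rightarrow>\<^sub>L 'a) \<Rightarrow> (real \<Rightarrow> 'a measure) \<Rightarrow> bool" where
  "mehler_measures T \<mu> \<longleftrightarrow>
     (\<forall>t\<ge>0. prob_space (\<mu> t) \<and> sets (\<mu> t) = sets borel) \<and>
     \<mu> 0 = return borel 0 \<and>
     (\<forall>f::'a \<Rightarrow> real. f \<in> bcontfun \<longrightarrow> continuous_on {0..} (\<lambda>t. \<integral>y. f y \<partial>\<mu> t)) \<and>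
     (\<forall>t>0. \<forall>s>0. \<mu> (t + s) =
        distr (distr (\<mu> t) borel (blinfun_apply (T s)) \<Otimes>\<^sub>M \<mu> s) borel (\<lambda>(x, y). x + y))"

definition mehler ::
  "(real \<Rightarrow> 'a::{banach, second_countable_topology} \<Rightarrow>\<^sub>L 'a) \<Rightarrow> (real \<Rightarrow> 'a measure) \<Rightarrow>
    real \<Rightarrow> ('a \<Rightarrow> real) \<Rightarrow> 'a \<Rightarrow> real" where
  "mehler T \<mu> t f x = (\<integral>y. f (T t x + y) \<partial>\<mu> t)"

text \<open>
  The generator \<open>L\<close> of the semigroup is by definition the closed operator with this resolvent, so
  \<open>mehler_resolvent T \<mu> lam\<close> is \<open>R(lam, L)\<close>.
\<close>

definition mehler_resolvent ::
  "(real \<Rightarrow> 'a::{banach, second_countable_topology} \<Rightarrow>\<^sub>L 'a) \<Rightarrow> (real \<Rightarrow> 'a measure) \<Rightarrow>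
    real \<Rightarrow> ('a \<Rightarrow> real) \<Rightarrow> 'a \<Rightarrow> real" where
  "mehler_resolvent T \<mu> lam f x = (LINT t:{0..}|lborel. exp (- lam * t) * mehler T \<mu> t f x)"

section \<open>Fomin differentiability\<close>

definition fomin_quotient :: "'a::real_normed_vector measure \<Rightarrow> 'a \<Rightarrow> 'a set \<Rightarrow> real \<Rightarrow> real" where
  "fomin_quotient M v A t = (measure M ((\<lambda>x. x + t *\<^sub>R v) ` A) - measure M A) / t"

definition fomin_differentiable :: "'a::real_normed_vector measure \<Rightarrow> 'a \<Rightarrow> bool" where
  "fomin_differentiable M v \<longleftrightarrow>
     (\<forall>A\<in>sets borel. \<exists>l. (fomin_quotient M v A \<longlongrightarrow> l) (at 0))"

text \<open>
  \<open>\<beta>\<close> is a density with respect to \<open>M\<close> of the derivative of \<open>M\<close> along \<open>v\<close>. It is unique up to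
  \<open>M\<close>-null sets.
\<close>

definition fomin_density :: "'a::real_normed_vector measure \<Rightarrow> 'a \<Rightarrow> ('a \<Rightarrow> real) \<Rightarrow> bool" where
  "fomin_density M v \<beta> \<longleftrightarrow>
     integrable M \<beta> \<and>
     (\<forall>A\<in>sets borel. (fomin_quotient M v A \<longlongrightarrow> (LINT y:A|M. \<beta> y)) (at 0))"

section \<open>Continuous multilinear forms\<close>

text \<open>
  An \<open>n\<close>-linear form on \<open>H\<close> is a function on lists, set to \<open>0\<close> on lists whose length is not \<open>n\<close>.
  For \<open>n = 0\<close> these forms are the real numbers, with \<open>multi_norm 0 T = \<bar>T []\<bar>\<close>. The norm takes
  values in \<open>ennreal\<close>, so that it is \<open>\<infinity>\<close> precisely for discontinuous forms.
\<close>

definition multi_norm :: "nat \<Rightarrow> ('h::real_normed_vector list \<Rightarrow> real) \<Rightarrow> ennreal" where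
  "multi_norm n T =
     (SUP hs \<in> {hs. length hs = n \<and> 0 \<notin> set hs}. ennreal (\<bar>T hs\<bar> / prod_list (map norm hs)))"

definition multi_forms :: "nat \<Rightarrow> ('h::real_normed_vector list \<Rightarrow> real) set" where
  "multi_forms n = {T.
     (\<forall>hs. length hs \<noteq> n \<longrightarrow> T hs = 0) \<and>
     (\<forall>hs k. length hs = n \<longrightarrow> k < n \<longrightarrow> linear (\<lambda>h. T (hs[k := h]))) \<and>
     multi_norm n T < \<infinity>}"

section \<open>Differentiability and Hoelder spaces along H\<close>

text \<open>
  \<open>T\<close> is the \<open>H\<close>-Gateaux derivative at \<open>x\<close> of a map \<open>F\<close> with values in the \<open>n\<close>-linear forms.
  The \<open>(n + 1)\<close>-linear form \<open>T\<close> is identified with the operator mapping \<open>h\<close> to the \<open>n\<close>-linear form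
  \<open>\<lambda>hs. T (h # hs)\<close>. The limit of difference quotients is taken in the norm of \<open>n\<close>-linear forms.
  There is at most one such \<open>T\<close>, because \<open>T\<close> vanishes on lists of any other length.
\<close>

definition has_H_derivative ::
  "('h::real_normed_vector \<Rightarrow>\<^sub>L 'a::real_normed_vector) \<Rightarrow> nat \<Rightarrow> ('a \<Rightarrow> 'h list \<Rightarrow> real) \<Rightarrow> 'a \<Rightarrow>
    ('h list \<Rightarrow> real) \<Rightarrow> bool" where
  "has_H_derivative i n F x T \<longleftrightarrow>
     T \<in> multi_forms (Suc n) \<and>
     (\<forall>h. ((\<lambda>t. multi_norm n (\<lambda>hs. (F (x + t *\<^sub>R i h) hs - F x hs) / t - T (h # hs)))
            \<longlongrightarrow> 0) (at 0))"

primrec H_deriv ::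
  "('h::real_normed_vector \<Rightarrow>\<^sub>L 'a::real_normed_vector) \<Rightarrow> ('a \<Rightarrow> real) \<Rightarrow> nat \<Rightarrow> 'a \<Rightarrow> 'h list \<Rightarrow> real"
where
  "H_deriv i f 0 = (\<lambda>x hs. if hs = [] then f x else 0)"
| "H_deriv i f (Suc n) = (\<lambda>x. THE T. has_H_derivative i n (H_deriv i f n) x T)"

text \<open>For \<open>n = 0\<close> the following set is \<open>bcontfun\<close>, with the sup norm.\<close>

definition CnH ::
  "('h::real_normed_vector \<Rightarrow>\<^sub>L 'a::real_normed_vector) \<Rightarrow> nat \<Rightarrow> ('a \<Rightarrow> real) set" where
  "CnH i n = {f \<in> bcontfun.
     (\<forall>k<n. \<forall>x. \<exists>T. has_H_derivative i k (H_deriv i f k) x T) \<and>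
     (\<forall>k\<in>{1..n}. \<forall>hs. length hs = k \<longrightarrow> (\<lambda>x. H_deriv i f k x hs) \<in> bcontfun)}"

definition sup_norm :: "('a \<Rightarrow> real) \<Rightarrow> ennreal" where
  "sup_norm f = (SUP x. ennreal \<bar>f x\<bar>)"

definition CnH_norm ::
  "('h::real_normed_vector \<Rightarrow>\<^sub>L 'a::real_normed_vector) \<Rightarrow> nat \<Rightarrow> ('a \<Rightarrow> real) \<Rightarrow> ennreal" where
  "CnH_norm i n f = sup_norm f + (\<Sum>k=1..n. SUP x. multi_norm k (H_deriv i f k x))"

definition H_holder_seminorm ::
  "('h::real_normed_vector \<Rightarrow>\<^sub>L 'a::real_normed_vector) \<Rightarrow> nat \<Rightarrow> real \<Rightarrow> ('a \<Rightarrow> 'h list \<Rightarrow> real) \<Rightarrow> ennreal"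
where
  "H_holder_seminorm i n \<sigma> F =
     (SUP x. SUP h\<in>-{0}. multi_norm n (\<lambda>hs. F (x + i h) hs - F x hs) / ennreal (norm h powr \<sigma>))"

text \<open>
  For a positive non-integer \<open>s\<close>, written as \<open>s = n + \<sigma>\<close> with \<open>n = \<lfloor>s\<rfloor>\<close> and \<open>\<sigma> = frac s\<close>, these are
  the space \<open>C\<^sup>s\<^sub>H(X)\<close> and its norm. They are not meant for integer \<open>s\<close>.
\<close>

definition CH ::
  "('h::real_normed_vector \<Rightarrow>\<^sub>L 'a::real_normed_vector) \<Rightarrow> real \<Rightarrow> ('a \<Rightarrow> real) set" where
  "CH i s = {f \<in> CnH i (nat \<lfloor>s\<rfloor>).
     H_holder_seminorm i (nat \<lfloor>s\<rfloor>) (frac s) (H_deriv i f (nat \<lfloor>s\<rfloor>)) < \<infinity>}"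

definition CH_norm ::
  "('h::real_normed_vector \<Rightarrow>\<^sub>L 'a::real_normed_vector) \<Rightarrow> real \<Rightarrow> ('a \<Rightarrow> real) \<Rightarrow> ennreal" where
  "CH_norm i s f = CnH_norm i (nat \<lfloor>s\<rfloor>) f +
     H_holder_seminorm i (nat \<lfloor>s\<rfloor>) (frac s) (H_deriv i f (nat \<lfloor>s\<rfloor>))"

end

theory Submission
  imports Defs
begin

text \<open>
  Fomin differentiability moves one derivative of \<open>P\<^sub>t f\<close> onto \<open>\<mu>\<^sub>t\<close>, at a cost of \<open>t\<^sup>-\<^sup>\<theta>\<close>, and the
  semigroup law together with \<open>D\<^sub>h (P\<^sub>s g) = P\<^sub>s (D\<^bsub>T\<^sub>s h\<^esub> g)\<close> iterates this to a bound
  \<open>t\<^bsup>-k\<theta>\<^esup>\<close> on the \<open>k\<close>-th derivative. If \<open>f\<close> is \<open>\<alpha>\<close>-Hoelder along \<open>H\<close>, the bound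
  improves to \<open>t\<^bsup>-(k-\<alpha>)\<theta>\<^esup>\<close>. Bounded functions are the case \<open>\<alpha> = 0\<close>, so (i) and (ii) have the same
  proof. The derivatives of order \<open>n < \<alpha> + 1/\<theta>\<close> pass under the Laplace integral. An increment of the
  \<open>n\<close>-th derivative along \<open>h\<close> is estimated by splitting the integral at \<open>t = \<parallel>h\<parallel>\<^bsup>1/\<theta>\<^esup>\<close>: below that time
  the two values are bounded separately (for \<open>n = 0\<close> their difference is at most a multiple of
  \<open>\<parallel>h\<parallel>\<^sup>\<alpha>\<close>), and above it the derivative of order \<open>n + 1\<close> is used.
\<close>

section \<open>Iterated derivatives along H\<close>

text \<open>The spaces are defined by a recursive \<open>THE\<close> and by limits in the norm of
  multilinear forms, whereas a Fomin density yields one scalar derivative per direction, with no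
  linearity in the direction built in. All estimates therefore concern iterated scalar derivatives.
  Linearity is recovered from their continuity, and limits in \<open>multi_norm\<close> from
  increment bounds that are uniform in the remaining directions. Put s = \<alpha> + 1/\<theta> and
  let n be its floor. Then n < s < n + 1 reads (n - \<alpha>) \<theta> < 1 < (n + 1 - \<alpha>)
  \<theta>: for n \<ge> 1 the bound of order n is integrable at time 0, and the bound of order n + 1
  is integrable at infinity. The strict left inequality is where s being no integer enters. At the
  chosen splitting time both parts become multiples of \<open>norm h powr (s - n)\<close>. The
  factor exp (\<omega> t) may outgrow exp (- \<open>lam\<close> t). Smoothing is therefore estimated
  for t \<le> 1, and sup-norm contractivity carries the bounds to later times. The Hoelder gain is
  used once, in the innermost derivative; the outer ones see only a bounded function.\<close>

definition H_dir_deriv ::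
  "('h::real_normed_vector \<Rightarrow>\<^sub>L 'a::real_normed_vector) \<Rightarrow> 'h \<Rightarrow> ('a \<Rightarrow> real) \<Rightarrow> 'a \<Rightarrow> real" where
  "H_dir_deriv i h g x = deriv (\<lambda>s. g (x + s *\<^sub>R i h)) 0"

text \<open>\<open>foldr\<close> differentiates along the last entry first, so the head of the list
  is the outermost derivative. This agrees with \<open>has_H_derivative\<close>, which puts the new
  direction at the head; writing a list as \<open>hs @ [h]\<close> exposes the innermost
  derivative.\<close>

definition H_dir_derivs ::
  "('h::real_normed_vector \<Rightarrow>\<^sub>L 'a::real_normed_vector) \<Rightarrow> 'h list \<Rightarrow> ('a \<Rightarrow> real) \<Rightarrow> 'a \<Rightarrow> real" where
  "H_dir_derivs i hs g = foldr (H_dir_deriv i) hs g"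

definition H_differentiable ::
  "('h::real_normed_vector \<Rightarrow>\<^sub>L 'a::real_normed_vector) \<Rightarrow> ('a \<Rightarrow> real) \<Rightarrow> bool" where
  "H_differentiable i g \<longleftrightarrow> (\<forall>x h. (\<lambda>s. g (x + s *\<^sub>R i h)) field_differentiable at 0)"

lemma H_dir_derivs_simps [simp]:
  "H_dir_derivs i [] g = g"
  "H_dir_derivs i (h # hs) g = H_dir_deriv i h (H_dir_derivs i hs g)"
  "H_dir_derivs i (hs @ ks) g = H_dir_derivs i hs (H_dir_derivs i ks g)"
  by (simp_all add: H_dir_derivs_def)

lemma H_dir_derivI:
  fixes i :: "'h::real_normed_vector \<Rightarrow>\<^sub>L 'a::real_normed_vector"
  assumes "((\<lambda>s. g (x + s *\<^sub>R i h)) has_real_derivative D) (at 0)"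
  shows "H_dir_deriv i h g x = D"
  using assms unfolding H_dir_deriv_def by (rule DERIV_imp_deriv)

lemma H_differentiableI:
  fixes i :: "'h::real_normed_vector \<Rightarrow>\<^sub>L 'a::real_normed_vector"
  assumes "\<And>x h. ((\<lambda>s. g (x + s *\<^sub>R i h)) has_real_derivative D x h) (at 0)"
  shows "H_differentiable i g"
  using assms unfolding H_differentiable_def field_differentiable_def by blast

lemma H_differentiable_has_derivative:
  assumes "H_differentiable i g"
  shows "((\<lambda>s. g (x + s *\<^sub>R i h)) has_real_derivative H_dir_deriv i h g (x + s *\<^sub>R i h)) (at s)"
proof -
  have "((\<lambda>r. g ((x + s *\<^sub>R i h) + r *\<^sub>R i h)) has_real_derivative
          H_dir_deriv i h g (x + s *\<^sub>R i h)) (at 0)"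
    using assms unfolding H_differentiable_def H_dir_deriv_def
    by (simp add: field_differentiable_derivI)
  then have "((\<lambda>r. g (x + (s + r) *\<^sub>R i h)) has_real_derivative
          H_dir_deriv i h g (x + s *\<^sub>R i h)) (at 0)"
    by (simp add: scaleR_add_left add.assoc)
  then show ?thesis
    using DERIV_shift[of "\<lambda>s. g (x + s *\<^sub>R i h)" "H_dir_deriv i h g (x + s *\<^sub>R i h)" 0 s]
    by (simp add: add.commute)
qed

lemma H_dir_deriv_scaleR:
  assumes "H_differentiable i g"
  shows "H_dir_deriv i (c *\<^sub>R h) g x = c * H_dir_deriv i h g x"
proof (rule H_dir_derivI)
  have *: "((\<lambda>s. g (x + s *\<^sub>R i h)) has_real_derivative H_dir_deriv i h g (x + (c*0) *\<^sub>R i h)) (at (c * 0))"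
    by (rule H_differentiable_has_derivative[OF assms])
  have "((\<lambda>s. c * s) has_real_derivative c) (at 0)"
    by (auto intro!: derivative_eq_intros)
  from DERIV_chain2[OF * this]
  show "((\<lambda>s. g (x + s *\<^sub>R i (c *\<^sub>R h))) has_real_derivative c * H_dir_deriv i h g x) (at 0)"
    by (simp add: blinfun.scaleR_right mult.commute)
qed

lemma H_mean_value:
  assumes "H_differentiable i g"
  obtains r where "0 < r" "r < 1" "g (x + i h) - g x = H_dir_deriv i h g (x + i (r *\<^sub>R h))"
proof -
  have "\<exists>r::real>0. r < 1 \<and> g (x + 1 *\<^sub>R i h) - g (x + 0 *\<^sub>R i h) =
      (1 - 0) * H_dir_deriv i h g (x + r *\<^sub>R i h)"
    by (rule MVT2) (auto intro!: H_differentiable_has_derivative assms)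
  then show thesis
    using that by (auto simp: blinfun.scaleR_right)
qed

lemma H_difference_le:
  assumes "H_differentiable i g" "\<And>y. \<bar>H_dir_deriv i h g y\<bar> \<le> B"
  shows "\<bar>g (x + i h) - g x\<bar> \<le> B"
proof -
  obtain r where "g (x + i h) - g x = H_dir_deriv i h g (x + i (r *\<^sub>R h))"
    using H_mean_value[OF assms(1)] by blast
  then show ?thesis using assms(2) by simp
qed

text \<open>For additivity, the step along h + k is a step along h followed by one along k. The mean
  value theorem turns the second into a derivative along k at a point that tends to x, and
  continuity of that derivative gives the limit.\<close>

lemma H_dir_deriv_linear:
  assumes g: "H_differentiable i g" and cont: "\<And>h. continuous_on UNIV (H_dir_deriv i h g)"
  shows "linear (\<lambda>h. H_dir_deriv i h g x)"
proof (rule linearI)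
  fix h k
  have "\<exists>r. \<bar>r\<bar> \<le> 1 \<and> g (x + s *\<^sub>R i h + i (s *\<^sub>R k)) - g (x + s *\<^sub>R i h) =
        s * H_dir_deriv i k g (x + s *\<^sub>R i h + i (r *\<^sub>R s *\<^sub>R k))" for s
  proof -
    obtain r where "0 < r" "r < 1"
      "g (x + s *\<^sub>R i h + i (s *\<^sub>R k)) - g (x + s *\<^sub>R i h) =
        H_dir_deriv i (s *\<^sub>R k) g (x + s *\<^sub>R i h + i (r *\<^sub>R s *\<^sub>R k))"
      using H_mean_value[OF g] .
    then show ?thesis
      by (intro exI[of _ r]) (simp add: H_dir_deriv_scaleR[OF g])
  qed
  then obtain r where r: "\<And>s. \<bar>r s\<bar> \<le> 1"
    "\<And>s. g (x + s *\<^sub>R i h + i (s *\<^sub>R k)) - g (x + s *\<^sub>R i h) =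
        s * H_dir_deriv i k g (x + s *\<^sub>R i h + i (r s *\<^sub>R s *\<^sub>R k))"
    by metis
  have "((\<lambda>s. r s * s) \<longlongrightarrow> 0) (at 0)"
  proof (rule tendsto_rabs_zero_cancel, rule tendsto_sandwich[where f="\<lambda>_. 0" and h="\<lambda>s. \<bar>s\<bar>"])
    show "\<forall>\<^sub>F s in at 0. \<bar>r s * s\<bar> \<le> \<bar>s\<bar>"
      using r(1) by (simp add: abs_mult mult_left_le_one_le)
  qed (auto intro: tendsto_eq_intros)
  then have "((\<lambda>s. x + s *\<^sub>R i h + (r s * s) *\<^sub>R i k) \<longlongrightarrow> x + 0 *\<^sub>R i h + 0 *\<^sub>R i k) (at 0)"
    by (intro tendsto_intros)
  then have "((\<lambda>s. H_dir_deriv i k g (x + s *\<^sub>R i h + (r s * s) *\<^sub>R i k)) \<longlongrightarrow> H_dir_deriv i k g x) (at 0)"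
    using isCont_tendsto_compose[of x "H_dir_deriv i k g"] cont[of k]
    by (simp add: continuous_on_eq_continuous_at)
  moreover have "((\<lambda>s. (g (x + s *\<^sub>R i h) - g x) / s) \<longlongrightarrow> H_dir_deriv i h g x) (at 0)"
    using H_differentiable_has_derivative[OF g, of x h 0] by (simp add: DERIV_def)
  ultimately have "((\<lambda>s. (g (x + s *\<^sub>R i h) - g x) / s
      + H_dir_deriv i k g (x + s *\<^sub>R i h + (r s * s) *\<^sub>R i k))
      \<longlongrightarrow> H_dir_deriv i h g x + H_dir_deriv i k g x) (at 0)"
    by (intro tendsto_intros)
  moreover have "\<forall>\<^sub>F s in at 0. (g (x + s *\<^sub>R i h) - g x) / s
      + H_dir_deriv i k g (x + s *\<^sub>R i h + (r s * s) *\<^sub>R i k)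
      = (g (x + s *\<^sub>R i (h + k)) - g x) / s"
    unfolding eventually_at_filter
  proof (intro always_eventually allI impI)
    fix s :: real assume "s \<noteq> 0"
    then show "(g (x + s *\<^sub>R i h) - g x) / s
      + H_dir_deriv i k g (x + s *\<^sub>R i h + (r s * s) *\<^sub>R i k)
      = (g (x + s *\<^sub>R i (h + k)) - g x) / s"
      using r(2)[of s]
      by (simp add: field_simps blinfun.scaleR_right blinfun.add_right scaleR_add_right)
  qed
  ultimately have "((\<lambda>s. (g (x + s *\<^sub>R i (h + k)) - g x) / s)
      \<longlongrightarrow> H_dir_deriv i h g x + H_dir_deriv i k g x) (at 0)"
    by (rule Lim_transform_eventually)
  then show "H_dir_deriv i (h + k) g x = H_dir_deriv i h g x + H_dir_deriv i k g x"
    by (intro H_dir_derivI) (simp add: DERIV_def)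
next
  show "H_dir_deriv i (c *\<^sub>R h) g x = c *\<^sub>R H_dir_deriv i h g x" for c h
    using H_dir_deriv_scaleR[OF g] by simp
qed

definition H_smooth ::
  "('h::real_normed_vector \<Rightarrow>\<^sub>L 'a::real_normed_vector) \<Rightarrow> nat \<Rightarrow> ('a \<Rightarrow> real) \<Rightarrow> bool" where
  "H_smooth i n g \<longleftrightarrow>
     (\<forall>hs. length hs < n \<longrightarrow> H_differentiable i (H_dir_derivs i hs g)) \<and>
     (\<forall>hs. length hs \<le> n \<longrightarrow> continuous_on UNIV (H_dir_derivs i hs g))"

text \<open>Linearity in the head is \<open>H_dir_deriv_linear\<close>. In a later slot the inner
  derivative is linear at every point by induction, and differentiating that identity along the head
  preserves it.\<close>

lemma H_dir_derivs_multilinear: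
  assumes "H_smooth i n g" "length hs \<le> n" "k < length hs"
  shows "linear (\<lambda>h. H_dir_derivs i (hs[k := h]) g x)"
  using assms(2,3)
proof (induction hs arbitrary: k x)
  case Nil
  then show ?case by simp
next
  case (Cons h0 hs)
  have diff: "H_differentiable i (H_dir_derivs i ks g)" if "length ks = length hs" for ks
    using assms(1) Cons.prems that by (auto simp: H_smooth_def)
  show ?case
  proof (cases k)
    case 0
    have "continuous_on UNIV (H_dir_deriv i h (H_dir_derivs i hs g))" for h
      using assms(1) Cons.prems
      by (auto simp: H_smooth_def simp del: H_dir_derivs_simps simp flip: H_dir_derivs_simps(2))
    then show ?thesis
      using 0 diff[of hs] by (simp add: H_dir_deriv_linear)
  next
    case (Suc m)
    then have m: "m < length hs" using Cons.prems by simp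
    have lin: "linear (\<lambda>h. H_dir_derivs i (hs[m := h]) g y)" for y
      using Cons m by simp
    note d = H_differentiable_has_derivative[OF diff, of _ x h0 0, simplified]
    show ?thesis
    proof (rule linearI)
      fix a b
      show "H_dir_derivs i ((h0 # hs)[k := a + b]) g x =
          H_dir_derivs i ((h0 # hs)[k := a]) g x + H_dir_derivs i ((h0 # hs)[k := b]) g x"
        using DERIV_add[OF d[of "hs[m := a]"] d[of "hs[m := b]"]] Suc linear_add[OF lin]
        by (auto intro!: H_dir_derivI)
    next
      fix c a
      show "H_dir_derivs i ((h0 # hs)[k := c *\<^sub>R a]) g x = c *\<^sub>R H_dir_derivs i ((h0 # hs)[k := a]) g x"
        using DERIV_cmult[OF d[of "hs[m := a]"], of c] Suc linear_scale[OF lin]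
        by (auto intro!: H_dir_derivI)
    qed
  qed
qed

section \<open>Norms of multilinear forms and uniqueness of the derivative\<close>

lemma prod_list_norm_nonneg [simp]: "0 \<le> prod_list (map norm hs)"
  by (induction hs) auto

lemma prod_list_norm_pos: "0 \<notin> set hs \<Longrightarrow> 0 < prod_list (map norm hs)"
  by (induction hs) auto

lemma multi_norm_leI:
  assumes "\<And>hs. length hs = n \<Longrightarrow> \<bar>T hs\<bar> \<le> b * prod_list (map norm hs)"
  shows "multi_norm n T \<le> ennreal b"
  unfolding multi_norm_def
proof (intro SUP_least ennreal_leI)
  fix hs :: "'a list" assume "hs \<in> {hs. length hs = n \<and> 0 \<notin> set hs}"
  then show "\<bar>T hs\<bar> / prod_list (map norm hs) \<le> b"
    using assms[of hs] prod_list_norm_pos[of hs] by (simp add: pos_divide_le_eq)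
qed

lemma multi_norm_0: "multi_norm 0 T = ennreal \<bar>T []\<bar>"
  unfolding multi_norm_def by (auto simp: cong: conj_cong)

lemma multi_forms_eq_0:
  assumes "T \<in> multi_forms n" "0 \<in> set hs"
  shows "T hs = 0"
proof (cases "length hs = n")
  case True
  obtain k where k: "k < length hs" "hs ! k = 0"
    using assms(2) by (auto simp: in_set_conv_nth)
  have "linear (\<lambda>h. T (hs[k := h]))"
    using assms(1) True k by (auto simp: multi_forms_def)
  from linear_0[OF this] k show ?thesis
    by (metis list_update_id)
qed (use assms in \<open>auto simp: multi_forms_def\<close>)

lemma multi_forms_le_multi_norm:
  assumes "0 \<notin> set hs" "length hs = n"
  shows "ennreal (\<bar>T hs\<bar> / prod_list (map norm hs)) \<le> multi_norm n T"
  unfolding multi_norm_def using assms by (intro SUP_upper) auto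

text \<open>Convergence in \<open>multi_norm\<close> forces convergence of the scalar quotients at
  each fixed list of nonzero directions, where limits are unique. All other lists carry the value 0
  for every form in \<open>multi_forms\<close>. This is what allows the \<open>THE\<close> in
  \<open>H_deriv\<close> to be evaluated.\<close>

lemma has_H_derivative_unique:
  assumes "has_H_derivative i n F x T" "has_H_derivative i n F x T'"
  shows "T = T'"
proof
  fix hs
  have T: "T \<in> multi_forms (Suc n)" "T' \<in> multi_forms (Suc n)"
    using assms by (auto simp: has_H_derivative_def)
  show "T hs = T' hs"
  proof (cases "length hs = Suc n \<and> 0 \<notin> set hs")
    case False
    then show ?thesis
      using T[THEN multi_forms_eq_0] T by (auto simp: multi_forms_def)
  next
    case True
    then obtain h ks where hs: "hs = h # ks" "length ks = n" "0 \<notin> set ks"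
      by (cases hs) auto
    have lim: "((\<lambda>t. (F (x + t *\<^sub>R i h) ks - F x ks) / t) \<longlongrightarrow> U (h # ks)) (at 0)"
      if U: "has_H_derivative i n F x U" for U
    proof -
      let ?p = "prod_list (map norm ks)"
      have p: "?p > 0" using hs prod_list_norm_pos by blast
      have "((\<lambda>t. ennreal (\<bar>(F (x + t *\<^sub>R i h) ks - F x ks) / t - U (h # ks)\<bar> / ?p)) \<longlongrightarrow> 0) (at 0)"
      proof (rule tendsto_sandwich[where f="\<lambda>_. 0"])
        show "\<forall>\<^sub>F t in at 0. ennreal (\<bar>(F (x + t *\<^sub>R i h) ks - F x ks) / t - U (h # ks)\<bar> / ?p)
          \<le> multi_norm n (\<lambda>hs. (F (x + t *\<^sub>R i h) hs - F x hs) / t - U (h # hs))"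
          using multi_forms_le_multi_norm[OF hs(3,2),
            of "\<lambda>hs. (F (x + _ *\<^sub>R i h) hs - F x hs) / _ - U (h # hs)"]
          by (auto intro!: always_eventually)
      qed (use U in \<open>auto simp: has_H_derivative_def\<close>)
      then have "((\<lambda>t. \<bar>(F (x + t *\<^sub>R i h) ks - F x ks) / t - U (h # ks)\<bar> / ?p) \<longlongrightarrow> 0) (at 0)"
        using p by (subst (asm) ennreal_0[symmetric], subst (asm) tendsto_ennreal_iff) auto
      from tendsto_mult[OF this tendsto_const[of ?p]] p
      have "((\<lambda>t. \<bar>(F (x + t *\<^sub>R i h) ks - F x ks) / t - U (h # ks)\<bar>) \<longlongrightarrow> 0) (at 0)"
        by simp
      then show ?thesis
        by (subst (asm) tendsto_rabs_zero_iff) (rule LIM_zero_cancel)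
    qed
    show ?thesis
      using tendsto_unique[OF _ lim[OF assms(1)] lim[OF assms(2)]] hs by simp
  qed
qed

section \<open>From bounds on scalar directional derivatives to membership in the spaces along
  \<open>H\<close>\<close>

context
  fixes i :: "'h::real_normed_vector \<Rightarrow>\<^sub>L 'a::real_normed_vector" and n :: nat
    and g :: "'a \<Rightarrow> real" and B \<sigma> :: real
  assumes smooth: "H_smooth i n g"
    and bound: "\<And>hs x. length hs \<le> n \<Longrightarrow> \<bar>H_dir_derivs i hs g x\<bar> \<le> B * prod_list (map norm hs)"
    and holder: "\<And>hs x h. length hs = n \<Longrightarrow>
      \<bar>H_dir_derivs i hs g (x + i h) - H_dir_derivs i hs g x\<bar> \<le> B * norm h powr \<sigma> * prod_list (map norm hs)"
    and \<sigma>: "\<sigma> > 0"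
begin

lemma H_criterion_nonneg: "B \<ge> 0"
  using order_trans[OF abs_ge_zero bound[of "[]"]] by simp

text \<open>At the top order this is the Hoelder assumption. Below it, the bound on the next
  derivative gives a Lipschitz modulus, \<tau> = 1. Uniformity in the directions \<open>hs\<close>
  is the point: it upgrades scalar limits to limits in \<open>multi_norm\<close>.\<close>

lemma H_criterion_modulus:
  assumes "k \<le> n"
  shows "\<exists>\<tau>>0. \<forall>hs x h. length hs = k \<longrightarrow>
      \<bar>H_dir_derivs i hs g (x + i h) - H_dir_derivs i hs g x\<bar> \<le> B * norm h powr \<tau> * prod_list (map norm hs)"
proof (cases "k = n")
  case True
  then show ?thesis using holder \<sigma> by blast
next
  case False
  have "\<bar>H_dir_derivs i hs g (x + i h) - H_dir_derivs i hs g x\<bar> \<le> B * norm h powr 1 * prod_list (map norm hs)"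
    if "length hs = k" for hs x h
    using bound[of "h # hs"] that False assms smooth
    by (intro H_difference_le) (auto simp: H_smooth_def mult.assoc)
  then show ?thesis by (intro exI[of _ 1]) auto
qed

lemma H_dir_derivs_in_multi_forms:
  assumes "k \<le> n"
  shows "(\<lambda>hs. if length hs = k then H_dir_derivs i hs g x else 0) \<in> multi_forms k" (is "?T \<in> _")
proof -
  have "multi_norm k ?T \<le> ennreal B"
    using bound assms by (intro multi_norm_leI) auto
  then have "multi_norm k ?T < \<infinity>"
    by (simp add: le_less_trans)
  then show ?thesis
    using H_dir_derivs_multilinear[OF smooth] assms
    by (auto simp: multi_forms_def)
qed

text \<open>By the mean value theorem the difference quotient is the derivative of order k + 1 at a
  point within \<open>\<bar>t\<bar> * norm h\<close> of x, measured in \<open>H\<close>. The modulus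
  of that order bounds the error by a constant times the product of the norms, uniformly in the
  remaining k directions.\<close>

lemma H_dir_derivs_has_H_derivative:
  assumes "k < n"
  shows "has_H_derivative i k (\<lambda>x hs. if length hs = k then H_dir_derivs i hs g x else 0) x
    (\<lambda>hs. if length hs = Suc k then H_dir_derivs i hs g x else 0)"
  unfolding has_H_derivative_def
proof (intro conjI allI)
  show "(\<lambda>hs. if length hs = Suc k then H_dir_derivs i hs g x else 0) \<in> multi_forms (Suc k)"
    using assms by (intro H_dir_derivs_in_multi_forms) simp
next
  fix h
  obtain \<tau> where \<tau>: "\<tau> > 0" "\<And>hs x h. length hs = Suc k \<Longrightarrow>
      \<bar>H_dir_derivs i hs g (x + i h) - H_dir_derivs i hs g x\<bar> \<le> B * norm h powr \<tau> * prod_list (map norm hs)"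
    using H_criterion_modulus[of "Suc k"] assms by auto
  have quotient: "\<bar>(H_dir_derivs i hs g (x + t *\<^sub>R i h) - H_dir_derivs i hs g x) / t - H_dir_derivs i (h # hs) g x\<bar>
      \<le> B * (\<bar>t\<bar> * norm h) powr \<tau> * norm h * prod_list (map norm hs)"
    if hs: "length hs = k" and t: "t \<noteq> 0" for hs t
  proof -
    have diff: "H_differentiable i (H_dir_derivs i hs g)"
      using smooth hs assms by (auto simp: H_smooth_def)
    obtain r where r: "0 < r" "r < 1" "H_dir_derivs i hs g (x + i (t *\<^sub>R h)) - H_dir_derivs i hs g x =
        H_dir_deriv i (t *\<^sub>R h) (H_dir_derivs i hs g) (x + i (r *\<^sub>R t *\<^sub>R h))"
      using H_mean_value[OF diff] by blast
    have "(H_dir_derivs i hs g (x + t *\<^sub>R i h) - H_dir_derivs i hs g x) / t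
        = H_dir_derivs i (h # hs) g (x + i ((r * t) *\<^sub>R h))"
      using r(3) t by (simp add: blinfun.scaleR_right H_dir_deriv_scaleR[OF diff])
    then have "\<bar>(H_dir_derivs i hs g (x + t *\<^sub>R i h) - H_dir_derivs i hs g x) / t - H_dir_derivs i (h # hs) g x\<bar>
      \<le> B * norm ((r * t) *\<^sub>R h) powr \<tau> * prod_list (map norm (h # hs))"
      using \<tau>(2)[of "h # hs" x "(r * t) *\<^sub>R h"] hs by simp
    also have "\<dots> \<le> B * (\<bar>t\<bar> * norm h) powr \<tau> * prod_list (map norm (h # hs))"
      using r \<tau>(1) H_criterion_nonneg
      by (intro mult_right_mono mult_left_mono powr_mono2)
         (auto simp: abs_mult mult_le_cancel_right2 simp del: list.map intro!: mult_right_mono)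
    finally show ?thesis by (simp add: mult_ac)
  qed
  show "((\<lambda>t. multi_norm k (\<lambda>hs.
      ((if length hs = k then H_dir_derivs i hs g (x + t *\<^sub>R i h) else 0)
        - (if length hs = k then H_dir_derivs i hs g x else 0)) / t -
      (if length (h # hs) = Suc k then H_dir_derivs i (h # hs) g x else 0))) \<longlongrightarrow> 0) (at 0)"
    (is "(?f \<longlongrightarrow> 0) _")
  proof (rule tendsto_sandwich[where f="\<lambda>_. 0"])
    show "\<forall>\<^sub>F t in at 0. ?f t \<le> ennreal (B * (\<bar>t\<bar> * norm h) powr \<tau> * norm h)"
      unfolding eventually_at_filter
      using quotient by (intro always_eventually allI impI multi_norm_leI) auto
    have "((\<lambda>t. B * (\<bar>t\<bar> * norm h) powr \<tau> * norm h) \<longlongrightarrow> B * (\<bar>0\<bar> * norm h) powr \<tau> * norm h) (at 0)"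
      using \<tau>(1) by (intro tendsto_intros) (auto intro!: tendsto_intros always_eventually)
    then show "((\<lambda>t. ennreal (B * (\<bar>t\<bar> * norm h) powr \<tau> * norm h)) \<longlongrightarrow> 0) (at 0)"
      by (intro tendsto_ennrealI[where x=0, simplified]) simp
  qed auto
qed

text \<open>The length test reproduces the convention that forms vanish on lists of the wrong
  length; without it uniqueness could not identify the \<open>THE\<close> with the scalar
  derivatives.\<close>

lemma H_deriv_eq_H_dir_derivs:
  assumes "k \<le> n"
  shows "H_deriv i g k = (\<lambda>x hs. if length hs = k then H_dir_derivs i hs g x else 0)"
  using assms
proof (induction k)
  case 0
  show ?case by (auto simp: fun_eq_iff)
next
  case (Suc k)
  let ?G = "\<lambda>k x hs. if length hs = k then H_dir_derivs i hs g x else 0"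
  have "(THE T. has_H_derivative i k (?G k) x T) = ?G (Suc k) x" for x
  proof (rule the_equality)
    show "has_H_derivative i k (?G k) x (?G (Suc k) x)"
      using H_dir_derivs_has_H_derivative[of k] Suc.prems by simp
    then show "T = ?G (Suc k) x" if "has_H_derivative i k (?G k) x T" for T
      using that by (rule has_H_derivative_unique[rotated])
  qed
  then show ?case
    using Suc by simp
qed

lemma H_criterion_CnH: "g \<in> CnH i n"
proof -
  have bc: "H_dir_derivs i hs g \<in> bcontfun" if "length hs \<le> n" for hs
    using smooth that bound[OF that]
    by (auto simp: bcontfun_def H_smooth_def bounded_iff)
  have "(\<lambda>x. H_deriv i g (length hs) x hs) \<in> bcontfun" if "length hs \<le> n" for hs
    using bc that by (simp add: H_deriv_eq_H_dir_derivs eta_contract_eq)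
  moreover have "\<exists>T. has_H_derivative i k (H_deriv i g k) x T" if "k < n" for k x
    using H_dir_derivs_has_H_derivative[OF that] that
    by (auto simp: H_deriv_eq_H_dir_derivs)
  ultimately show ?thesis
    using bc[of "[]"] by (auto simp: CnH_def)
qed

text \<open>The factor n + 1 counts the sup norm and the n derivative terms, each at most B.\<close>

lemma H_criterion_CnH_norm: "CnH_norm i n g \<le> ennreal (real (Suc n) * B)"
proof -
  have "sup_norm g \<le> ennreal B"
    using bound[of "[]"] by (auto simp: sup_norm_def intro!: SUP_least ennreal_leI)
  moreover have "(\<Sum>k=1..n. SUP x. multi_norm k (H_deriv i g k x)) \<le> (\<Sum>k=1..n. ennreal B)"
    using bound
    by (intro sum_mono SUP_least multi_norm_leI) (auto simp: H_deriv_eq_H_dir_derivs)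
  ultimately have "CnH_norm i n g \<le> ennreal B + (\<Sum>k=1..n. ennreal B)"
    unfolding CnH_norm_def by (rule add_mono)
  also have "\<dots> = ennreal B + ennreal (\<Sum>k=1..n. B)"
    using H_criterion_nonneg by (subst sum_ennreal) auto
  also have "\<dots> = ennreal (real (Suc n) * B)"
    using H_criterion_nonneg by (subst ennreal_plus[symmetric]) (auto simp: algebra_simps)
  finally show ?thesis .
qed

lemma H_criterion_holder: "H_holder_seminorm i n \<sigma> (H_deriv i g n) \<le> ennreal B"
  unfolding H_holder_seminorm_def
proof (intro SUP_least)
  fix x and h :: 'h assume "h \<in> -{0}"
  then have h: "norm h powr \<sigma> > 0" by simp
  have "multi_norm n (\<lambda>hs. H_deriv i g n (x + i h) hs - H_deriv i g n x hs) \<le> ennreal (B * norm h powr \<sigma>)"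
    using holder by (intro multi_norm_leI) (simp add: H_deriv_eq_H_dir_derivs)
  then have "multi_norm n (\<lambda>hs. H_deriv i g n (x + i h) hs - H_deriv i g n x hs) / ennreal (norm h powr \<sigma>)
      \<le> ennreal (B * norm h powr \<sigma>) / ennreal (norm h powr \<sigma>)"
    by (rule divide_right_mono_ennreal)
  also have "\<dots> = ennreal B"
    using h H_criterion_nonneg by (subst divide_ennreal) auto
  finally show "multi_norm n (\<lambda>hs. H_deriv i g n (x + i h) hs - H_deriv i g n x hs) / ennreal (norm h powr \<sigma>) \<le> ennreal B" .
qed

end

section \<open>Fomin densities\<close>

lemma abs_integral_le:
  fixes f :: "'a \<Rightarrow> real"
  assumes "integrable M f" "integrable M g" "\<And>x. x \<in> space M \<Longrightarrow> \<bar>f x\<bar> \<le> g x"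
  shows "\<bar>\<integral>x. f x \<partial>M\<bar> \<le> (\<integral>x. g x \<partial>M)"
proof -
  have "\<bar>\<integral>x. f x \<partial>M\<bar> \<le> (\<integral>x. \<bar>f x\<bar> \<partial>M)" by (rule integral_abs_bound)
  also have "\<dots> \<le> (\<integral>x. g x \<partial>M)" using assms by (intro integral_mono) auto
  finally show ?thesis .
qed

lemma continuous_on_integral_dominated:
  fixes F :: "'a::metric_space \<Rightarrow> 'b \<Rightarrow> real"
  assumes meas: "\<And>x. F x \<in> borel_measurable M"
    and cont: "\<And>y. y \<in> space M \<Longrightarrow> continuous_on UNIV (\<lambda>x. F x y)"
    and w: "integrable M w" "\<And>x y. y \<in> space M \<Longrightarrow> \<bar>F x y\<bar> \<le> w y"
  shows "continuous_on UNIV (\<lambda>x. \<integral>y. F x y \<partial>M)"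
  unfolding continuous_on_sequentially
proof (clarsimp simp: comp_def)
  fix X and x :: 'a assume X: "X \<longlonglongrightarrow> x"
  show "(\<lambda>n. \<integral>y. F (X n) y \<partial>M) \<longlonglongrightarrow> (\<integral>y. F x y \<partial>M)"
  proof (rule integral_dominated_convergence[where w=w])
    show "AE y in M. (\<lambda>n. F (X n) y) \<longlonglongrightarrow> F x y"
      using cont X by (intro AE_I2) (auto simp: continuous_on_sequentially comp_def)
  qed (use meas w in auto)
qed

text \<open>A bound on the derivative for all parameters bounds every difference quotient by the
  same \<open>w\<close>, so dominated convergence applies. Measurability of the derivative follows
  from its being a pointwise limit of quotients.\<close>

lemma has_real_derivative_integral:
  fixes \<phi> :: "real \<Rightarrow> 'b \<Rightarrow> real"
  assumes int: "\<And>r. integrable M (\<phi> r)"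
    and der: "\<And>r y. y \<in> space M \<Longrightarrow> ((\<lambda>r. \<phi> r y) has_real_derivative \<phi>' r y) (at r)"
    and w: "integrable M w" "\<And>r y. y \<in> space M \<Longrightarrow> \<bar>\<phi>' r y\<bar> \<le> w y"
  shows "((\<lambda>r. \<integral>y. \<phi> r y \<partial>M) has_real_derivative (\<integral>y. \<phi>' 0 y \<partial>M)) (at 0)"
  unfolding DERIV_def tendsto_at_iff_sequentially
proof (clarsimp simp: comp_def)
  fix X :: "nat \<Rightarrow> real" assume X: "\<forall>n. X n \<noteq> 0" "X \<longlonglongrightarrow> 0"
  have meas: "(\<lambda>y. (\<phi> (X n) y - \<phi> 0 y) / X n) \<in> borel_measurable M" for n
    using int by (intro borel_measurable_divide borel_measurable_diff) auto
  have lim: "(\<lambda>n. (\<phi> (X n) y - \<phi> 0 y) / X n) \<longlonglongrightarrow> \<phi>' 0 y" if "y \<in> space M" for y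
    using der[OF that, of 0] X by (auto simp: DERIV_def tendsto_at_iff_sequentially comp_def)
  have le: "\<bar>(\<phi> s y - \<phi> 0 y) / s\<bar> \<le> w y" if y: "y \<in> space M" and s: "s \<noteq> 0" for s y
  proof -
    have "norm (\<phi> s y - \<phi> 0 y) \<le> w y * norm (s - 0)"
      using der[OF y] w(2)[OF y]
      by (intro field_differentiable_bound[of UNIV _ "\<lambda>r. \<phi>' r y"]) (auto intro: has_field_derivative_at_within)
    then show ?thesis using s by (simp add: field_simps)
  qed
  have "(\<lambda>n. \<integral>y. (\<phi> (X n) y - \<phi> 0 y) / X n \<partial>M) \<longlonglongrightarrow> (\<integral>y. \<phi>' 0 y \<partial>M)"
  proof (rule integral_dominated_convergence[where w=w])
    show "\<phi>' 0 \<in> borel_measurable M"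
      using lim meas by (rule borel_measurable_LIMSEQ_real)
    show "AE y in M. norm ((\<phi> (X n) y - \<phi> 0 y) / X n) \<le> w y" for n
      using le[OF _ X(1)[rule_format]] by (intro AE_I2) (simp only: real_norm_def)
  qed (use meas lim w in auto)
  then show "(\<lambda>n. ((\<integral>y. \<phi> (X n) y \<partial>M) - (\<integral>y. \<phi> 0 y \<partial>M)) / X n) \<longlonglongrightarrow> (\<integral>y. \<phi>' 0 y \<partial>M)"
    using int by simp
qed

lemma bcontfun_bounds:
  assumes "f \<in> bcontfun"
  obtains B where "\<And>x. \<bar>f x :: real\<bar> \<le> B"
  using assms unfolding bcontfun_def bounded_iff by auto

lemma bcontfunI':
  assumes "continuous_on UNIV f" "\<And>x. \<bar>f x :: real\<bar> \<le> B"
  shows "f \<in> bcontfun"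
  using assms by (auto simp: bcontfun_def bounded_iff)

lemma bcontfun_continuous: "f \<in> bcontfun \<Longrightarrow> continuous_on UNIV f"
  by (simp add: bcontfun_def)

lemma bcontfun_compose:
  assumes "f \<in> bcontfun" "continuous_on UNIV g"
  shows "(\<lambda>x. f (g x)) \<in> bcontfun"
  using assms continuous_on_compose2[of UNIV f UNIV g]
  by (auto simp: bcontfun_def intro: bounded_subset)

lemma bcontfun_measurable:
  fixes f :: "'a::topological_space \<Rightarrow> real"
  assumes "f \<in> bcontfun" "sets M = sets borel"
  shows "f \<in> borel_measurable M"
  using borel_measurable_continuous_onI[OF bcontfun_continuous[OF assms(1)]]
  by (simp add: measurable_cong_sets[OF assms(2) refl])

lemma bcontfun_integrable:
  fixes f :: "'a::topological_space \<Rightarrow> real"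
  assumes "f \<in> bcontfun" "prob_space M" "sets M = sets borel"
  shows "integrable M f"
proof -
  interpret prob_space M by fact
  obtain B where "\<And>x. \<bar>f x\<bar> \<le> B" using bcontfun_bounds[OF assms(1)] by blast
  then show ?thesis
    by (intro integrable_const_bound[where B=B]) (auto simp: bcontfun_measurable assms)
qed

lemma integrable_bounded_mult:
  fixes b :: "'a \<Rightarrow> real"
  assumes "integrable M b" "f \<in> borel_measurable M" "\<And>y. \<bar>f y\<bar> \<le> B"
  shows "integrable M (\<lambda>y. f y * b y)"
proof (rule Bochner_Integration.integrable_bound[where f="\<lambda>y. B * b y"])
  have "\<bar>f y\<bar> * \<bar>b y\<bar> \<le> \<bar>B\<bar> * \<bar>b y\<bar>" for y
    using assms(3)[of y] by (intro mult_right_mono) auto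
  then show "AE y in M. norm (f y * b y) \<le> norm (B * b y)"
    by (simp add: abs_mult)
qed (use assms in auto)

lemma abs_integral_mult_le:
  fixes b :: "'a \<Rightarrow> real"
  assumes "integrable M b" "f \<in> borel_measurable M" "\<And>y. \<bar>f y\<bar> \<le> B"
  shows "\<bar>\<integral>y. f y * b y \<partial>M\<bar> \<le> B * (\<integral>y. \<bar>b y\<bar> \<partial>M)"
proof -
  have "\<bar>\<integral>y. f y * b y \<partial>M\<bar> \<le> (\<integral>y. B * \<bar>b y\<bar> \<partial>M)"
  proof (rule abs_integral_le)
    show "\<bar>f y * b y\<bar> \<le> B * \<bar>b y\<bar>" for y
      using assms(3)[of y] by (auto simp: abs_mult intro!: mult_right_mono)
  qed (use assms integrable_bounded_mult[OF assms] in auto)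
  then show ?thesis by simp
qed

text \<open>Values are rounded down to multiples of e; boundedness leaves only finitely many of
  them.\<close>

lemma simple_uniform_approx:
  fixes f :: "'a \<Rightarrow> real"
  assumes "f \<in> borel_measurable M" "\<And>y. \<bar>f y\<bar> \<le> B" "e > 0"
  obtains J :: "int set" and A c where "finite J" "\<And>j. A j \<in> sets M"
    "\<And>y. y \<in> space M \<Longrightarrow> \<bar>f y - (\<Sum>j\<in>J. c j * indicator (A j) y)\<bar> \<le> e"
proof
  \<comment> \<open>Every possible value of \<open>\<lfloor>f y / e\<rfloor>\<close> lies in this
    interval because -B \<le> f \<le> B.\<close>
  define J where "J = {\<lfloor>-B / e\<rfloor>..\<lfloor>B / e\<rfloor>}"
  define A where "A j = {y \<in> space M. \<lfloor>f y / e\<rfloor> = j}" for j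
  show "finite J" by (simp add: J_def)
  show "A j \<in> sets M" for j
    using assms(1) unfolding A_def by measurable
  fix y assume y: "y \<in> space M"
  have "-B \<le> f y" "f y \<le> B" using assms(2)[of y] by linarith+
  then have "-B / e \<le> f y / e" "f y / e \<le> B / e"
    using assms(3) by (intro divide_right_mono; simp)+
  then have "\<lfloor>f y / e\<rfloor> \<in> J"
    unfolding J_def by (simp add: floor_mono)
  then have "(\<Sum>j\<in>J. (e * of_int j) * indicator (A j) y) = e * of_int \<lfloor>f y / e\<rfloor>"
    using y by (subst sum.remove[of J "\<lfloor>f y / e\<rfloor>"]) (auto simp: J_def A_def indicator_def intro!: sum.neutral)
  moreover have "f y - e * of_int \<lfloor>f y / e\<rfloor> = e * (f y / e - of_int \<lfloor>f y / e\<rfloor>)"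
    using assms(3) by (simp add: field_simps)
  moreover have "0 \<le> f y / e - of_int \<lfloor>f y / e\<rfloor>" "f y / e - of_int \<lfloor>f y / e\<rfloor> \<le> 1"
    by linarith+
  ultimately show "\<bar>f y - (\<Sum>j\<in>J. (e * of_int j) * indicator (A j) y)\<bar> \<le> e"
    using assms(3) by (simp add: abs_mult)
qed

section \<open>Fomin differentiability tested on bounded measurable functions\<close>

context
  fixes M :: "'a::{banach, second_countable_topology} measure" and v :: 'a and b :: "'a \<Rightarrow> real"
  assumes M: "prob_space M" "sets M = sets borel" and b: "fomin_density M v b"
begin

interpretation prob_space M by (rule M(1))

lemma fomin_measurable_shift: "f \<in> borel_measurable borel \<Longrightarrow> (\<lambda>y. f (y - s *\<^sub>R v) :: real) \<in> borel_measurable M"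
  by (subst measurable_cong_sets[OF M(2) refl]) (rule measurable_compose[of _ _ borel], auto)

lemma fomin_integrable: "integrable M b"
  using b by (simp add: fomin_density_def)

text \<open>The function is the indicator of the translate A + s v. Translates compose, so the Fomin
  quotient of the set A + s v at 0 is the difference quotient of the measure of A + s v at s.
  Applying the hypothesis to all translates thus gives the derivative at every s.\<close>

lemma fomin_indicator:
  assumes A: "A \<in> sets borel"
  shows "((\<lambda>s. \<integral>y. indicator A (y - s *\<^sub>R v) \<partial>M) has_real_derivative
    (\<integral>y. indicator A (y - s *\<^sub>R v) * b y \<partial>M)) (at s)"
proof -
  define S where "S s = (\<lambda>x. x + s *\<^sub>R v) ` A" for s
  have S_eq: "S s = {y. y - s *\<^sub>R v \<in> A}" for s
    unfolding S_def by (auto intro!: image_eqI[of _ _ "_ - s *\<^sub>R v"])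
  have "(\<lambda>y. y - s *\<^sub>R v) -` A \<inter> space borel \<in> sets borel" for s
    using A by (intro measurable_sets[of _ borel borel]) auto
  then have S: "S s \<in> sets borel" for s
    by (simp add: S_eq vimage_def)
  have ind: "indicator A (y - s *\<^sub>R v) = (indicator (S s) y :: real)" for s y
    by (simp add: S_eq indicator_def)
  have shift: "(\<lambda>x. x + t *\<^sub>R v) ` S s = S (s + t)" for s t
    unfolding S_def image_image by (simp add: scaleR_add_left add_ac)
  have "(fomin_quotient M v (S s) \<longlongrightarrow> (LINT y:S s|M. b y)) (at 0)"
    using b S by (auto simp: fomin_density_def)
  then have "((\<lambda>s. measure M (S s)) has_real_derivative (\<integral>y. indicator (S s) y * b y \<partial>M)) (at s)"
    unfolding DERIV_def fomin_quotient_def shift set_lebesgue_integral_def by simp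
  then show ?thesis
    using S by (simp add: ind M(2))
qed

text \<open>The measure is differentiated, so \<open>f\<close> need not be even continuous. The
  claim holds for simple functions by linearity. For uniform approximations with error 1/(n+1), the
  derivatives converge uniformly in s, with error at most 1/(n+1) times the L1 norm of
  \<open>b\<close>, so the limit may be differentiated.\<close>

lemma fomin_has_derivative:
  assumes f: "f \<in> borel_measurable borel" and B: "\<And>y. \<bar>f y\<bar> \<le> B"
  shows "((\<lambda>s. \<integral>y. f (y - s *\<^sub>R v) \<partial>M) has_real_derivative
    (\<integral>y. f (y - s *\<^sub>R v) * b y \<partial>M)) (at s)"
proof -
  define simp_fun where "simp_fun g \<longleftrightarrow> (\<exists>(J::int set) A c. finite J \<and> (\<forall>j. A j \<in> sets borel) \<and>
    g = (\<lambda>y. \<Sum>j\<in>J. c j * indicator (A j) y))" for g :: "'a \<Rightarrow> real"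
  have "\<forall>n. \<exists>g. simp_fun g \<and> (\<forall>y. \<bar>f y - g y\<bar> \<le> inverse (Suc n))"
  proof
    fix n
    obtain J :: "int set" and A c where "finite J" "\<And>j. A j \<in> sets borel"
      "\<And>y. \<bar>f y - (\<Sum>j\<in>J. c j * indicator (A j) y)\<bar> \<le> inverse (Suc n)"
      using simple_uniform_approx[OF f B, of "inverse (Suc n)"] by auto
    then show "\<exists>g. simp_fun g \<and> (\<forall>y. \<bar>f y - g y\<bar> \<le> inverse (Suc n))"
      unfolding simp_fun_def by blast
  qed
  from choice[OF this] obtain g where g: "\<And>n. simp_fun (g n)"
    and fg: "\<And>n y. \<bar>f y - g n y\<bar> \<le> inverse (Suc n)"
    by blast
  have g_meas: "g n \<in> borel_measurable borel" for n
  proof -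
    obtain J :: "int set" and A c where "\<And>j. A j \<in> sets borel"
      and gn: "g n = (\<lambda>y. \<Sum>j\<in>J. c j * indicator (A j) y)"
      using g[of n] unfolding simp_fun_def by blast
    then show ?thesis
      unfolding gn by (intro borel_measurable_sum borel_measurable_times borel_measurable_indicator) auto
  qed
  have g_bd: "\<bar>g n y\<bar> \<le> B + 1" for n y
  proof -
    have "inverse (real (Suc n)) \<le> 1" by (simp add: field_simps)
    then show ?thesis using fg[of y n] B[of y] by linarith
  qed
  have int_f: "integrable M (\<lambda>y. f (y - s *\<^sub>R v))" for s
    using B by (intro integrable_const_bound[where B=B] fomin_measurable_shift f) auto
  have int_g: "integrable M (\<lambda>y. g n (y - s *\<^sub>R v))" for n s
    using g_bd by (intro integrable_const_bound[where B="B + 1"] fomin_measurable_shift g_meas) auto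
  note int_fb = integrable_bounded_mult[OF fomin_integrable fomin_measurable_shift[OF f] B]
  note int_gb = integrable_bounded_mult[OF fomin_integrable fomin_measurable_shift[OF g_meas] g_bd]
  have der_g: "((\<lambda>s. \<integral>y. g n (y - s *\<^sub>R v) \<partial>M) has_real_derivative
    (\<integral>y. g n (y - s *\<^sub>R v) * b y \<partial>M)) (at s)" for n s
  proof -
    obtain J :: "int set" and A c where J: "finite J" "\<And>j. A j \<in> sets borel"
      and gn: "g n = (\<lambda>y. \<Sum>j\<in>J. c j * indicator (A j) y)"
      using g[of n] unfolding simp_fun_def by blast
    have int_A: "integrable M (\<lambda>y. indicator (A j) (y - s *\<^sub>R v) :: real)" for j s
      using J by (intro integrable_const_bound[where B=1] fomin_measurable_shift) auto
    have int_Ab: "integrable M (\<lambda>y. indicator (A j) (y - s *\<^sub>R v) * b y)" for j s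
      using J by (intro integrable_bounded_mult[where B=1] fomin_integrable fomin_measurable_shift) auto
    have "(\<integral>y. g n (y - s *\<^sub>R v) \<partial>M) = (\<Sum>j\<in>J. c j * (\<integral>y. indicator (A j) (y - s *\<^sub>R v) \<partial>M))" for s
      unfolding gn using int_A by (subst Bochner_Integration.integral_sum) auto
    moreover have "(\<integral>y. g n (y - s *\<^sub>R v) * b y \<partial>M) =
        (\<Sum>j\<in>J. c j * (\<integral>y. indicator (A j) (y - s *\<^sub>R v) * b y \<partial>M))"
      unfolding gn sum_distrib_right mult.assoc using int_Ab
      by (subst Bochner_Integration.integral_sum) auto
    ultimately show ?thesis
      using J by (auto intro!: DERIV_sum DERIV_cmult fomin_indicator)
  qed
  have conv: "(\<lambda>n. \<integral>y. g n (y - s *\<^sub>R v) \<partial>M) \<longlonglongrightarrow> (\<integral>y. f (y - s *\<^sub>R v) \<partial>M)" for s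
  proof (rule LIM_zero_cancel, rule tendsto_rabs_zero_cancel, rule tendsto_sandwich[where f="\<lambda>_. 0"])
    show "\<forall>\<^sub>F n in sequentially. \<bar>(\<integral>y. g n (y - s *\<^sub>R v) \<partial>M) - (\<integral>y. f (y - s *\<^sub>R v) \<partial>M)\<bar> \<le> inverse (Suc n)"
    proof (intro always_eventually allI)
      fix n
      have "\<bar>\<integral>y. g n (y - s *\<^sub>R v) - f (y - s *\<^sub>R v) \<partial>M\<bar> \<le> (\<integral>y. inverse (Suc n) \<partial>M)"
        using fg by (intro abs_integral_le Bochner_Integration.integrable_diff int_f int_g)
          (auto simp: abs_minus_commute)
      then show "\<bar>(\<integral>y. g n (y - s *\<^sub>R v) \<partial>M) - (\<integral>y. f (y - s *\<^sub>R v) \<partial>M)\<bar> \<le> inverse (Suc n)"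
        by (simp add: int_f int_g prob_space)
    qed
  qed (auto intro: LIMSEQ_inverse_real_of_nat simp del: of_nat_Suc)
  define L where "L = (\<integral>y. \<bar>b y\<bar> \<partial>M)"
  have L: "L \<ge> 0" unfolding L_def by simp
  have close: "\<bar>(\<integral>y. g n (y - s *\<^sub>R v) * b y \<partial>M) - (\<integral>y. f (y - s *\<^sub>R v) * b y \<partial>M)\<bar> \<le> inverse (Suc n) * L" for n s
  proof -
    have "\<bar>\<integral>y. (g n (y - s *\<^sub>R v) - f (y - s *\<^sub>R v)) * b y \<partial>M\<bar> \<le> inverse (Suc n) * L"
      unfolding L_def using fg
      by (intro abs_integral_mult_le fomin_integrable borel_measurable_diff fomin_measurable_shift f g_meas)
        (auto simp: abs_minus_commute)
    then show ?thesis
      by (simp add: left_diff_distrib int_fb int_gb)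
  qed
  have "\<exists>G. \<forall>s\<in>UNIV. (\<lambda>n. \<integral>y. g n (y - s *\<^sub>R v) \<partial>M) \<longlonglongrightarrow> G s \<and>
      (G has_derivative (\<lambda>h. (\<integral>y. f (y - s *\<^sub>R v) * b y \<partial>M) * h)) (at s within UNIV)"
  proof (rule has_derivative_sequence[where f="\<lambda>n s. \<integral>y. g n (y - s *\<^sub>R v) \<partial>M", OF convex_UNIV _ _ UNIV_I conv[of 0]])
    show "((\<lambda>s. \<integral>y. g n (y - s *\<^sub>R v) \<partial>M) has_derivative
        (\<lambda>h. (\<integral>y. g n (y - s *\<^sub>R v) * b y \<partial>M) * h)) (at s within UNIV)" for n s
      using der_g by (simp add: has_field_derivative_def)
    fix e :: real assume e: "e > 0"
    have "(\<lambda>n. inverse (real (Suc n)) * L) \<longlonglongrightarrow> 0 * L"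
      by (intro tendsto_intros LIMSEQ_inverse_real_of_nat)
    then have "\<forall>\<^sub>F n in sequentially. inverse (real (Suc n)) * L < e"
      using e by (intro order_tendstoD) auto
    then show "\<forall>\<^sub>F n in sequentially. \<forall>s\<in>UNIV. \<forall>h. norm ((\<integral>y. g n (y - s *\<^sub>R v) * b y \<partial>M) * h
        - (\<integral>y. f (y - s *\<^sub>R v) * b y \<partial>M) * h) \<le> e * norm h"
    proof (rule eventually_mono, intro ballI allI)
      fix n s h assume n: "inverse (real (Suc n)) * L < e"
      have "\<bar>(\<integral>y. g n (y - s *\<^sub>R v) * b y \<partial>M) - (\<integral>y. f (y - s *\<^sub>R v) * b y \<partial>M)\<bar> * \<bar>h\<bar> \<le> e * \<bar>h\<bar>"
        using close[of n s] n by (intro mult_right_mono) auto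
      then show "norm ((\<integral>y. g n (y - s *\<^sub>R v) * b y \<partial>M) * h
        - (\<integral>y. f (y - s *\<^sub>R v) * b y \<partial>M) * h) \<le> e * norm h"
        by (simp add: abs_mult flip: left_diff_distrib)
    qed
  qed
  then obtain G where G: "\<And>s. (\<lambda>n. \<integral>y. g n (y - s *\<^sub>R v) \<partial>M) \<longlonglongrightarrow> G s"
    "\<And>s. (G has_derivative (\<lambda>h. (\<integral>y. f (y - s *\<^sub>R v) * b y \<partial>M) * h)) (at s)"
    by auto
  have "G = (\<lambda>s. \<integral>y. f (y - s *\<^sub>R v) \<partial>M)"
    using LIMSEQ_unique[OF G(1) conv] by auto
  then show ?thesis
    using G(2) by (simp add: has_field_derivative_def)
qed

end

section \<open>Derivatives of the Mehler semigroup\<close>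

locale mehler_semigroup =
  fixes T :: "real \<Rightarrow> 'a::{banach, second_countable_topology} \<Rightarrow>\<^sub>L 'a"
    and \<mu> :: "real \<Rightarrow> 'a measure"
    and i :: "'h::banach \<Rightarrow>\<^sub>L 'a"
    and M C \<theta> \<omega> :: real
  assumes semigroup: "strongly_continuous_semigroup T"
    and measures: "mehler_measures T \<mu>"
    and M_pos: "M > 0" and C_pos: "C > 0" and \<theta>_pos: "\<theta> > 0"
    and T_H: "\<And>t h. t > 0 \<Longrightarrow> \<exists>k. T t (i h) = i k \<and> norm k \<le> M * exp (\<omega> * t) * norm h"
    and density: "\<And>t h. t > 0 \<Longrightarrow> \<exists>\<beta>. fomin_density (\<mu> t) (T t (i h)) \<beta> \<and>
           (\<integral>y. \<bar>\<beta> y\<bar> \<partial>\<mu> t) \<le> C * exp (\<omega> * t) * t powr (- \<theta>) * norm h"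
begin

abbreviation P :: "real \<Rightarrow> ('a \<Rightarrow> real) \<Rightarrow> 'a \<Rightarrow> real" where "P \<equiv> mehler T \<mu>"

text \<open>The restriction of T_t to \<open>H\<close>, obtained pointwise by choosing an element of
  \<open>H\<close> that represents T_t h. It is meaningful for t > 0.\<close>

definition S :: "real \<Rightarrow> 'h \<Rightarrow> 'h" where
  "S t h = (SOME k. T t (i h) = i k \<and> norm k \<le> M * exp (\<omega> * t) * norm h)"

text \<open>\<open>exp \<bar>\<omega>\<bar>\<close> bounds \<open>exp (\<omega> * t)\<close> on 0 <
  t \<le> 1 for either sign of \<omega>. The constant \<open>C1\<close> has the same origin.\<close>

definition M1 :: real where "M1 = M * exp \<bar>\<omega>\<bar>"

definition C1 :: real where "C1 = C * exp \<bar>\<omega>\<bar>"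

lemma M1_pos: "M1 > 0" and C1_pos: "C1 > 0"
  using M_pos C_pos by (auto simp: M1_def C1_def)

lemma exp_le_exp_abs: "0 < t \<Longrightarrow> t \<le> 1 \<Longrightarrow> exp (\<omega> * t) \<le> exp \<bar>\<omega>\<bar>"
  using mult_mono[of \<omega> "\<bar>\<omega>\<bar>" t 1] by auto

lemma S_eq: "t > 0 \<Longrightarrow> T t (i h) = i (S t h)"
  and S_norm: "t > 0 \<Longrightarrow> norm (S t h) \<le> M * exp (\<omega> * t) * norm h"
  unfolding S_def using someI_ex[OF T_H[of t h]] by auto

lemma S_norm_le_1:
  assumes "0 < t" "t \<le> 1"
  shows "norm (S t h) \<le> M1 * norm h"
proof -
  have "norm (S t h) \<le> M * exp (\<omega> * t) * norm h" by (rule S_norm[OF assms(1)])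
  also have "\<dots> \<le> M * exp \<bar>\<omega>\<bar> * norm h"
    using exp_le_exp_abs[OF assms] M_pos by (intro mult_right_mono mult_left_mono) auto
  finally show ?thesis by (simp add: M1_def)
qed

section \<open>Contractivity, continuity and the semigroup law of \<open>P\<close>\<close>

lemma prob_mu: "t \<ge> 0 \<Longrightarrow> prob_space (\<mu> t)" and sets_mu: "t \<ge> 0 \<Longrightarrow> sets (\<mu> t) = sets borel"
  using measures by (auto simp: mehler_measures_def)

lemma measurable_mu_iff: "t \<ge> 0 \<Longrightarrow> f \<in> borel_measurable (\<mu> t) \<longleftrightarrow> f \<in> borel_measurable borel"
  using measurable_cong_sets[OF sets_mu refl] by blast

lemma translate_bcontfun: "f \<in> bcontfun \<Longrightarrow> (\<lambda>y. f (z + y)) \<in> bcontfun" for z :: 'a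
  by (rule bcontfun_compose) (auto intro: continuous_intros)

lemma integrable_translate:
  fixes f :: "'a \<Rightarrow> real"
  assumes "t \<ge> 0" "f \<in> bcontfun"
  shows "integrable (\<mu> t) (\<lambda>y. f (z + y))"
  using assms by (intro bcontfun_integrable translate_bcontfun prob_mu sets_mu)

lemma P_bound:
  assumes "t \<ge> 0" "f \<in> bcontfun" "\<And>x. \<bar>f x\<bar> \<le> N"
  shows "\<bar>P t f x\<bar> \<le> N"
proof -
  interpret prob_space "\<mu> t" using assms by (intro prob_mu)
  have "\<bar>\<integral>y. f (T t x + y) \<partial>\<mu> t\<bar> \<le> (\<integral>y. N \<partial>\<mu> t)"
    using assms(3) prob_space_axioms
    by (intro abs_integral_le[OF integrable_translate[OF assms(1,2)]]) auto
  then show ?thesis by (simp add: mehler_def prob_space)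
qed

text \<open>The weight \<open>b\<close> serves two purposes: with b = 1 it gives continuity of
  \<open>P t f\<close>, and with a Fomin density it gives continuity of the derivative of
  \<open>P t f\<close>.\<close>

lemma translate_integral_continuous:
  fixes f :: "'a \<Rightarrow> real"
  assumes "t \<ge> 0" "f \<in> bcontfun" "integrable (\<mu> t) b"
  shows "continuous_on UNIV (\<lambda>z. \<integral>y. f (z + y) * b y \<partial>\<mu> t)"
proof -
  obtain N where N: "\<And>x. \<bar>f x\<bar> \<le> N" using bcontfun_bounds[OF assms(2)] by blast
  show ?thesis
  proof (rule continuous_on_integral_dominated[where w="\<lambda>y. N * \<bar>b y\<bar>"])
    show "(\<lambda>y. f (z + y) * b y) \<in> borel_measurable (\<mu> t)" for z
      using integrable_translate[OF assms(1,2)] assms(3) by (intro borel_measurable_times) auto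
    show "continuous_on UNIV (\<lambda>z. f (z + y) * b y)" for y
      by (intro continuous_intros continuous_on_compose2[OF bcontfun_continuous[OF assms(2)]]) auto
    show "\<bar>f (z + y) * b y\<bar> \<le> N * \<bar>b y\<bar>" for z y
      using N by (auto simp: abs_mult intro: mult_right_mono)
  qed (use assms in auto)
qed

lemma P_bcontfun:
  assumes "t \<ge> 0" "f \<in> bcontfun"
  shows "P t f \<in> bcontfun"
proof -
  interpret prob_space "\<mu> t" using assms by (intro prob_mu)
  obtain N where N: "\<And>x. \<bar>f x\<bar> \<le> N" using bcontfun_bounds[OF assms(2)] by blast
  have "continuous_on UNIV (\<lambda>z. \<integral>y. f (z + y) \<partial>\<mu> t)"
    using translate_integral_continuous[OF assms, of "\<lambda>_. 1"] by simp
  then have "continuous_on UNIV (P t f)"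
    unfolding mehler_def by (rule continuous_on_compose2) (auto intro: continuous_intros)
  then show ?thesis
    using P_bound[OF assms N] by (rule bcontfunI')
qed

text \<open>The convolution identity for \<mu> and Fubini give a double integral of f (T_(t+s) x +
  T_s w + y). Since T_(t+s) x + T_s w = T_s (T_t x + w), the inner integral is \<open>P s f\<close>
  at T_t x + w.\<close>

lemma P_semigroup:
  assumes t: "t > 0" and s: "s > 0" and f: "f \<in> bcontfun"
  shows "P (t + s) f = P t (P s f)"
proof
  fix x
  let ?D = "distr (\<mu> t) borel (T s)"
  interpret t: prob_space "\<mu> t" using t by (intro prob_mu) simp
  interpret s: prob_space "\<mu> s" using s by (intro prob_mu) simp
  have T_meas: "blinfun_apply (T s) \<in> borel_measurable (\<mu> t)"
    using t by (subst measurable_mu_iff) (auto intro!: borel_measurable_continuous_onI continuous_intros)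
  interpret D: prob_space ?D using T_meas by (rule t.prob_space_distr)
  interpret pair_prob_space ?D "\<mu> s" ..
  obtain N where N: "\<And>x. \<bar>f x\<bar> \<le> N" using bcontfun_bounds[OF f] by blast
  have sets_pair: "sets (?D \<Otimes>\<^sub>M \<mu> s) = sets (borel :: ('a \<times> 'a) measure)"
    using s by (simp add: sets_mu borel_prod[symmetric] cong: sets_pair_measure_cong)
  have add_meas: "(\<lambda>(x, y). x + y) \<in> borel_measurable (?D \<Otimes>\<^sub>M \<mu> s)"
    by (subst measurable_cong_sets[OF sets_pair refl])
       (auto simp: split_beta intro!: borel_measurable_continuous_onI continuous_intros)
  define z where "z = T (t + s) x"
  have z: "z = T s (T t x)"
    using semigroup t s unfolding z_def strongly_continuous_semigroup_def
    by (simp add: add.commute[of t s])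
  have fz: "(\<lambda>y. f (z + y)) \<in> borel_measurable borel"
    using translate_bcontfun[OF f] by (intro bcontfun_measurable) auto
  have "P (t + s) f x = (\<integral>y. f (z + y) \<partial>distr (?D \<Otimes>\<^sub>M \<mu> s) borel (\<lambda>(x, y). x + y))"
    using measures t s unfolding mehler_def mehler_measures_def z_def by simp
  also have "\<dots> = (\<integral>p. f (z + (fst p + snd p)) \<partial>(?D \<Otimes>\<^sub>M \<mu> s))"
    by (subst integral_distr[OF add_meas fz]) (simp add: split_beta)
  also have "\<dots> = (\<integral>w. (\<integral>y. f (z + (w + y)) \<partial>\<mu> s) \<partial>?D)"
  proof (subst integral_fst'[symmetric])
    show "integrable (?D \<Otimes>\<^sub>M \<mu> s) (\<lambda>p. f (z + (fst p + snd p)))"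
      using N measurable_compose[OF add_meas fz]
      by (intro integrable_const_bound[where B=N]) (auto simp: split_beta)
  qed simp
  also have "\<dots> = (\<integral>w. (\<integral>y. f (z + (T s w + y)) \<partial>\<mu> s) \<partial>\<mu> t)"
  proof (rule integral_distr[OF T_meas])
    have "continuous_on UNIV (\<lambda>z. \<integral>y. f (z + y) \<partial>\<mu> s)"
      using translate_integral_continuous[of s f "\<lambda>_. 1"] s f by simp
    then have "continuous_on UNIV (\<lambda>w. \<integral>y. f ((z + w) + y) \<partial>\<mu> s)"
      by (rule continuous_on_compose2) (auto intro: continuous_intros)
    then show "(\<lambda>w. \<integral>y. f (z + (w + y)) \<partial>\<mu> s) \<in> borel_measurable borel"
      by (intro borel_measurable_continuous_onI) (simp add: add.assoc)
  qed
  also have "\<dots> = P t (P s f) x"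
    by (simp add: mehler_def z blinfun.add_right add.assoc)
  finally show "P (t + s) f x = P t (P s f) x" .
qed

text \<open>Moving x by s h moves the argument of f by s T_t h, which is the translation family of
  \<open>fomin_has_derivative\<close> at -s; hence the minus sign. The density is obtained before f
  and x are chosen, so a single \<open>b\<close> serves all of them.\<close>

lemma P_derivative:
  assumes t: "t > 0"
  obtains b where "integrable (\<mu> t) b"
    "(\<integral>y. \<bar>b y\<bar> \<partial>\<mu> t) \<le> C * exp (\<omega> * t) * t powr (- \<theta>) * norm h"
    "\<And>f x. f \<in> bcontfun \<Longrightarrow>
      ((\<lambda>s. P t f (x + s *\<^sub>R i h)) has_real_derivative - (\<integral>y. f (T t x + y) * b y \<partial>\<mu> t)) (at 0)"
proof -
  obtain b where b: "fomin_density (\<mu> t) (T t (i h)) b"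
      "(\<integral>y. \<bar>b y\<bar> \<partial>\<mu> t) \<le> C * exp (\<omega> * t) * t powr (- \<theta>) * norm h"
    using density[OF t] by blast
  have mu: "prob_space (\<mu> t)" "sets (\<mu> t) = sets borel"
    using t by (simp_all add: prob_mu sets_mu)
  show thesis
  proof (rule that[OF fomin_integrable[OF mu b(1)] b(2)])
    fix f :: "'a \<Rightarrow> real" and x assume f: "f \<in> bcontfun"
    obtain N where N: "\<And>x. \<bar>f x\<bar> \<le> N" using bcontfun_bounds[OF f] by blast
    have fx: "(\<lambda>y. f (T t x + y)) \<in> borel_measurable borel"
      using translate_bcontfun[OF f] by (intro bcontfun_measurable) auto
    have "((\<lambda>s. \<integral>y. f (T t x + (y - s *\<^sub>R T t (i h))) \<partial>\<mu> t) has_real_derivative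
        (\<integral>y. f (T t x + (y - (- 0) *\<^sub>R T t (i h))) * b y \<partial>\<mu> t)) (at (- 0))"
      using fomin_has_derivative[OF mu b(1) fx N] by blast
    moreover have "(uminus has_real_derivative -1) (at (0::real))"
      by (auto intro!: derivative_eq_intros)
    ultimately have "((\<lambda>s. \<integral>y. f (T t x + (y - (- s) *\<^sub>R T t (i h))) \<partial>\<mu> t) has_real_derivative
        (\<integral>y. f (T t x + (y - (- 0) *\<^sub>R T t (i h))) * b y \<partial>\<mu> t) * -1) (at 0)"
      by (rule DERIV_chain2)
    then show "((\<lambda>s. P t f (x + s *\<^sub>R i h)) has_real_derivative
        - (\<integral>y. f (T t x + y) * b y \<partial>\<mu> t)) (at 0)"
      by (simp add: mehler_def blinfun.add_right blinfun.scaleR_right add_ac)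
  qed
qed

section \<open>Differentiability of \<open>P t f\<close> to every order\<close>

lemma P_H_differentiable:
  assumes "t > 0" "f \<in> bcontfun"
  shows "H_differentiable i (P t f)"
  unfolding H_differentiable_def field_differentiable_def
proof (intro allI)
  fix x h
  show "\<exists>D. ((\<lambda>s. P t f (x + s *\<^sub>R i h)) has_field_derivative D) (at 0)"
    by (rule P_derivative[OF assms(1), of h]) (use assms(2) in blast)
qed

lemma P_H_dir_deriv:
  assumes t: "t > 0"
  obtains b where "integrable (\<mu> t) b"
    "(\<integral>y. \<bar>b y\<bar> \<partial>\<mu> t) \<le> C * exp (\<omega> * t) * t powr (- \<theta>) * norm h"
    "\<And>f x. f \<in> bcontfun \<Longrightarrow> H_dir_deriv i h (P t f) x = - (\<integral>y. f (T t x + y) * b y \<partial>\<mu> t)"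
  by (rule P_derivative[OF t, of h]) (rule that, auto intro: H_dir_derivI)

lemma P_H_dir_deriv_bcontfun:
  assumes t: "t > 0" and f: "f \<in> bcontfun"
  shows "H_dir_deriv i h (P t f) \<in> bcontfun"
proof -
  obtain N where N: "\<And>x. \<bar>f x\<bar> \<le> N" using bcontfun_bounds[OF f] by blast
  obtain b where b: "integrable (\<mu> t) b"
    "\<And>f x. f \<in> bcontfun \<Longrightarrow> H_dir_deriv i h (P t f) x = - (\<integral>y. f (T t x + y) * b y \<partial>\<mu> t)"
    by (rule P_H_dir_deriv[OF t, of h]) blast
  have "continuous_on UNIV (\<lambda>z. \<integral>y. f (z + y) * b y \<partial>\<mu> t)"
    using t f b by (intro translate_integral_continuous) auto
  then have "continuous_on UNIV (\<lambda>x. \<integral>y. f (T t x + y) * b y \<partial>\<mu> t)"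
    by (rule continuous_on_compose2) (auto intro: continuous_intros)
  then have "continuous_on UNIV (H_dir_deriv i h (P t f))"
    unfolding b(2)[OF f] by (rule continuous_on_minus)
  moreover have "\<bar>H_dir_deriv i h (P t f) x\<bar> \<le> N * (\<integral>y. \<bar>b y\<bar> \<partial>\<mu> t)" for x
    unfolding b(2)[OF f] abs_minus_cancel using b(1) t f N integrable_translate[of t f]
    by (intro abs_integral_mult_le) auto
  ultimately show ?thesis by (rule bcontfunI')
qed

text \<open>Shifting x by h shifts the integrand's argument by T_s h, which is represented by
  \<open>S s h\<close>. The derivative of g in that direction is bounded, so a constant dominates
  under the probability measure.\<close>

lemma P_commute:
  assumes s: "s > 0" and g: "g \<in> bcontfun" "H_differentiable i g"
    and g': "H_dir_deriv i (S s h) g \<in> bcontfun"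
  shows "H_dir_deriv i h (P s g) = P s (H_dir_deriv i (S s h) g)"
proof
  fix x
  interpret prob_space "\<mu> s" using s by (intro prob_mu) simp
  obtain N where N: "\<And>x. \<bar>H_dir_deriv i (S s h) g x\<bar> \<le> N" using bcontfun_bounds[OF g'] by blast
  have "((\<lambda>r. \<integral>y. g (T s x + y + r *\<^sub>R i (S s h)) \<partial>\<mu> s) has_real_derivative
    (\<integral>y. H_dir_deriv i (S s h) g (T s x + y + 0 *\<^sub>R i (S s h)) \<partial>\<mu> s)) (at 0)"
  proof (rule has_real_derivative_integral[where w="\<lambda>_. N"])
    show "integrable (\<mu> s) (\<lambda>y. g (T s x + y + r *\<^sub>R i (S s h)))" for r
      using integrable_translate[of s g "T s x + r *\<^sub>R i (S s h)"] s g by (simp add: add_ac)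
  qed (use N H_differentiable_has_derivative[OF g(2)] in auto)
  then show "H_dir_deriv i h (P s g) x = P s (H_dir_deriv i (S s h) g) x"
    by (intro H_dir_derivI)
       (simp add: mehler_def blinfun.add_right blinfun.scaleR_right S_eq[OF s] add_ac)
qed

text \<open>Half of the time pays for this derivative; the other half is kept outside as a smoothing
  operator. The derivative again has the form \<open>P (t / 2) g\<close> with g bounded and
  continuous, so the procedure can be repeated.\<close>

lemma P_half_step:
  assumes t: "t > 0" and f: "f \<in> bcontfun"
  shows "H_dir_deriv i h (P t f) = P (t / 2) (H_dir_deriv i (S (t / 2) h) (P (t / 2) f))"
proof -
  have "P t f = P (t / 2) (P (t / 2) f)"
    using P_semigroup[of "t / 2" "t / 2" f] t f by simp
  then show ?thesis
    using t f by (simp add: P_commute P_bcontfun P_H_differentiable P_H_dir_deriv_bcontfun)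
qed

text \<open>Reverse induction removes the innermost derivative. The half step replaces it by a new
  bounded continuous function at time t / 2, which is why t and f must be arbitrary in the
  induction.\<close>

lemma P_smooth:
  assumes "t > 0" "f \<in> bcontfun"
  shows "H_differentiable i (H_dir_derivs i hs (P t f)) \<and> H_dir_derivs i hs (P t f) \<in> bcontfun"
  using assms
proof (induction hs arbitrary: t f rule: rev_induct)
  case Nil
  then show ?case by (simp add: P_H_differentiable P_bcontfun)
next
  case (snoc h hs)
  then show ?case
    by (simp add: P_half_step[OF snoc.prems] P_H_dir_deriv_bcontfun)
qed

text \<open>For \<open>\<alpha> = 0\<close> the increment bound is \<open>N\<close>, except at \<open>h = 0\<close>, where \<open>0 powr 0 = 0\<close>.\<close>

definition H_hoelder :: "real \<Rightarrow> real \<Rightarrow> ('a \<Rightarrow> real) \<Rightarrow> bool" where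
  "H_hoelder \<alpha> N f \<longleftrightarrow> f \<in> bcontfun \<and> (\<forall>x. \<bar>f x\<bar> \<le> N) \<and>
     (\<forall>x h. \<bar>f (x + i h) - f x\<bar> \<le> N * norm h powr \<alpha>)"

lemma H_hoelder_bcontfun: "H_hoelder \<alpha> N f \<Longrightarrow> f \<in> bcontfun"
  and H_hoelder_bound: "H_hoelder \<alpha> N f \<Longrightarrow> \<bar>f x\<bar> \<le> N"
  and H_hoelder_diff: "H_hoelder \<alpha> N f \<Longrightarrow> \<bar>f (x + i h) - f x\<bar> \<le> N * norm h powr \<alpha>"
  by (auto simp: H_hoelder_def)

lemma H_hoelder_nonneg: "H_hoelder \<alpha> N f \<Longrightarrow> N \<ge> 0"
  using H_hoelder_bound[of \<alpha> N f] abs_ge_zero order_trans by blast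

text \<open>The constant doubles because an increment is bounded by two values of f.\<close>

lemma H_hoelder_0:
  assumes "f \<in> bcontfun" "\<And>x. \<bar>f x\<bar> \<le> N"
  shows "H_hoelder 0 (2 * N) f"
proof -
  have "N \<ge> 0" using assms(2)[of 0] by linarith
  moreover have "\<bar>f (x + i h) - f x\<bar> \<le> 2 * N * norm h powr 0" for x h
    using assms(2)[of "x + i h"] assms(2)[of x] by (cases "h = 0") auto
  ultimately show ?thesis
    unfolding H_hoelder_def using assms(1) order_trans[OF assms(2), of "2 * N"] by auto
qed

text \<open>This uses no smoothing: a shift by h at x becomes a shift by \<open>S t h\<close> inside
  the integral, and averaging preserves the increment bound.\<close>

lemma P_H_difference:
  assumes t: "t > 0" and f: "H_hoelder \<alpha> N f"
  shows "\<bar>P t f (x + i h) - P t f x\<bar> \<le> N * norm (S t h) powr \<alpha>"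
proof -
  interpret prob_space "\<mu> t" using t by (intro prob_mu) simp
  note int = integrable_translate[of t f, OF _ H_hoelder_bcontfun[OF f]]
  have "P t f (x + i h) - P t f x = (\<integral>y. f (T t x + y + i (S t h)) - f (T t x + y) \<partial>\<mu> t)"
    using t int[of "T t x"] int[of "T t x + i (S t h)"]
    by (subst Bochner_Integration.integral_diff) (auto simp: mehler_def blinfun.add_right S_eq add_ac)
  also have "\<bar>\<dots>\<bar> \<le> (\<integral>y. N * norm (S t h) powr \<alpha> \<partial>\<mu> t)"
  proof (rule abs_integral_le)
    show "integrable (\<mu> t) (\<lambda>y. f (T t x + y + i (S t h)) - f (T t x + y))"
      using t int[of "T t x"] int[of "T t x + i (S t h)"]
      by (intro Bochner_Integration.integrable_diff) (auto simp: add_ac)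
  qed (use H_hoelder_diff[OF f] in auto)
  finally show ?thesis by (simp add: prob_space)
qed

text \<open>
  By the mean value theorem, the derivative at some point of the segment from \<open>x\<close> to
  \<open>x + \<epsilon> h\<close> is a difference quotient of \<open>P\<^sub>t f\<close>. Moving back to \<open>x\<close> changes the derivative by an
  integral of an increment of \<open>f\<close> against \<open>\<beta>\<close>. The choice \<open>\<epsilon> = t\<^sup>\<theta> / \<parallel>h\<parallel>\<close> balances the two errors.
\<close>

lemma P_H_dir_deriv_bound:
  assumes t: "0 < t" "t \<le> 1" and f: "H_hoelder \<alpha> N f" and \<alpha>: "0 \<le> \<alpha>"
  shows "\<bar>H_dir_deriv i h (P t f) x\<bar> \<le> M1 powr \<alpha> * (1 + C1) * t powr (- ((1 - \<alpha>) * \<theta>)) * norm h * N"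
proof (cases "h = 0")
  case True
  have "H_dir_deriv i (0 *\<^sub>R h) (P t f) x = 0 * H_dir_deriv i h (P t f) x"
    by (rule H_dir_deriv_scaleR[OF P_H_differentiable]) (use t f H_hoelder_bcontfun in auto)
  then show ?thesis using True by simp
next
  case False
  note bc = H_hoelder_bcontfun[OF f]
  have N: "N \<ge> 0" by (rule H_hoelder_nonneg[OF f])
  define \<epsilon> where "\<epsilon> = t powr \<theta> / norm h"
  have \<epsilon>: "\<epsilon> > 0" using t False by (simp add: \<epsilon>_def)
  \<comment> \<open>Every displacement c h with c \<le> \<epsilon> satisfies
    \<open>norm (S t (c *\<^sub>R h)) \<le> M1 * t powr \<theta>\<close>, so A bounds the
    \<alpha>-th power of all norms occurring below.\<close>
  define A where "A = (M1 * t powr \<theta>) powr \<alpha>"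
  have small: "norm (S t (c *\<^sub>R h)) powr \<alpha> \<le> A" if "0 \<le> c" "c \<le> \<epsilon>" for c
  proof -
    have "norm (S t (c *\<^sub>R h)) \<le> M1 * (c * norm h)"
      using S_norm_le_1[OF t, of "c *\<^sub>R h"] that by simp
    also have "\<dots> \<le> M1 * (\<epsilon> * norm h)"
      using that M1_pos by (intro mult_left_mono mult_right_mono) auto
    also have "\<dots> = M1 * t powr \<theta>" using False by (simp add: \<epsilon>_def)
    finally show ?thesis unfolding A_def using \<alpha> by (intro powr_mono2) auto
  qed
  obtain b where b: "integrable (\<mu> t) b"
    "(\<integral>y. \<bar>b y\<bar> \<partial>\<mu> t) \<le> C * exp (\<omega> * t) * t powr (- \<theta>) * norm h"
    "\<And>f x. f \<in> bcontfun \<Longrightarrow> H_dir_deriv i h (P t f) x = - (\<integral>y. f (T t x + y) * b y \<partial>\<mu> t)"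
    by (rule P_H_dir_deriv[OF t(1), of h]) blast
  have "C * exp (\<omega> * t) * t powr (- \<theta>) * norm h \<le> C1 * t powr (- \<theta>) * norm h"
    unfolding C1_def using exp_le_exp_abs[OF t] C_pos by (intro mult_right_mono mult_left_mono) auto
  then have b_le: "(\<integral>y. \<bar>b y\<bar> \<partial>\<mu> t) \<le> C1 * t powr (- \<theta>) * norm h"
    using b(2) by linarith
  obtain r where r: "0 < r" "r < 1" "P t f (x + i (\<epsilon> *\<^sub>R h)) - P t f x =
      H_dir_deriv i (\<epsilon> *\<^sub>R h) (P t f) (x + i (r *\<^sub>R \<epsilon> *\<^sub>R h))"
    using H_mean_value[OF P_H_differentiable[OF t(1) bc]] .
  \<comment> \<open>The mean value point is x + i k. Since r < 1, the displacement k is again of the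
    form c h with c \<le> \<epsilon>, so \<open>small\<close> also controls the way back to
    x.\<close>
  define k where "k = (r * \<epsilon>) *\<^sub>R h"
  have quot: "P t f (x + i (\<epsilon> *\<^sub>R h)) - P t f x = \<epsilon> * H_dir_deriv i h (P t f) (x + i k)"
    using r(3) by (simp add: H_dir_deriv_scaleR[OF P_H_differentiable[OF t(1) bc]] k_def)
  have "\<epsilon> * \<bar>H_dir_deriv i h (P t f) (x + i k)\<bar> = \<bar>P t f (x + i (\<epsilon> *\<^sub>R h)) - P t f x\<bar>"
    using \<epsilon> by (simp add: quot abs_mult)
  also have "\<dots> \<le> N * norm (S t (\<epsilon> *\<^sub>R h)) powr \<alpha>"
    by (rule P_H_difference[OF t(1) f])
  also have "\<dots> \<le> N * A"
    using small[of \<epsilon>] N \<epsilon> by (intro mult_left_mono) auto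
  finally have 1: "\<bar>H_dir_deriv i h (P t f) (x + i k)\<bar> \<le> N * A * t powr (- \<theta>) * norm h"
    using \<epsilon> False t by (simp add: \<epsilon>_def field_simps powr_minus)
  have int: "integrable (\<mu> t) (\<lambda>y. f (z + y) * b y)" for z
    using integrable_translate[of t f z] t bc H_hoelder_bound[OF f] b(1)
    by (intro integrable_bounded_mult[where B=N]) auto
  have "H_dir_deriv i h (P t f) x - H_dir_deriv i h (P t f) (x + i k) =
      (\<integral>y. (f (T t x + y + i (S t k)) - f (T t x + y)) * b y \<partial>\<mu> t)"
    using int[of "T t x"] int[of "T t x + i (S t k)"] t
    by (simp add: b(3)[OF bc] left_diff_distrib blinfun.add_right S_eq add_ac)
  also have "\<bar>\<dots>\<bar> \<le> N * A * (\<integral>y. \<bar>b y\<bar> \<partial>\<mu> t)"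
  proof (rule abs_integral_mult_le[OF b(1)])
    show "(\<lambda>y. f (T t x + y + i (S t k)) - f (T t x + y)) \<in> borel_measurable (\<mu> t)"
      using integrable_translate[of t f "T t x"] integrable_translate[of t f "T t x + i (S t k)"] t bc
      by (intro borel_measurable_diff) (auto simp: add_ac)
    have "norm (S t k) powr \<alpha> \<le> A"
      unfolding k_def using r \<epsilon> by (intro small) (auto simp: mult_left_le_one_le)
    then show "\<bar>f (T t x + y + i (S t k)) - f (T t x + y)\<bar> \<le> N * A" for y
      using H_hoelder_diff[OF f, of "T t x + y" "S t k"] N mult_left_mono[of _ A N] by force
  qed
  also have "\<dots> \<le> N * A * (C1 * t powr (- \<theta>) * norm h)"
    using b_le N by (intro mult_left_mono) (auto simp: A_def)
  finally have "\<bar>H_dir_deriv i h (P t f) x\<bar> \<le> N * A * (C1 * t powr (- \<theta>) * norm h) + N * A * t powr (- \<theta>) * norm h"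
    using 1 by linarith
  also have "\<dots> = M1 powr \<alpha> * (1 + C1) * t powr (- ((1 - \<alpha>) * \<theta>)) * norm h * N"
  proof -
    have "A * t powr (- \<theta>) = M1 powr \<alpha> * t powr (- ((1 - \<alpha>) * \<theta>))"
      unfolding A_def using M1_pos
      by (simp add: powr_mult powr_powr powr_add[symmetric] algebra_simps)
    moreover have "N * A * (C1 * t powr (- \<theta>) * norm h) + N * A * t powr (- \<theta>) * norm h =
        (A * t powr (- \<theta>)) * (1 + C1) * norm h * N"
      by (simp add: algebra_simps)
    ultimately show ?thesis by (simp add: mult_ac)
  qed
  finally show ?thesis .
qed

text \<open>The two hypotheses are deliberately asymmetric. The innermost derivative uses a bound
  particular to f, which may carry the Hoelder gain; the outer ones are applied to the
  differentiated function, about which only a sup bound is known. Each acts at time t / 2, which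
  produces \<open>2 powr (c + a)\<close>.\<close>

lemma P_derivs_bound_snoc:
  assumes t: "0 < t" "t \<le> 1" and f: "f \<in> bcontfun"
    and A: "A \<ge> 0" "\<And>t h x. 0 < t \<Longrightarrow> t \<le> 1 \<Longrightarrow> \<bar>H_dir_deriv i h (P t f) x\<bar> \<le> A * t powr (- a) * norm h"
    and K: "K \<ge> 0" "\<And>t g N x. 0 < t \<Longrightarrow> t \<le> 1 \<Longrightarrow> g \<in> bcontfun \<Longrightarrow> (\<And>x. \<bar>g x\<bar> \<le> N) \<Longrightarrow>
      \<bar>H_dir_derivs i hs (P t g) x\<bar> \<le> K * t powr (- c) * prod_list (map norm hs) * N"
  shows "\<bar>H_dir_derivs i (hs @ [h]) (P t f) x\<bar> \<le>
    K * A * M1 * 2 powr (c + a) * t powr (- (c + a)) * prod_list (map norm (hs @ [h]))"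
proof -
  let ?g = "H_dir_deriv i (S (t / 2) h) (P (t / 2) f)"
  have g: "\<bar>?g x\<bar> \<le> A * (t / 2) powr (- a) * (M1 * norm h)" for x
  proof -
    have "\<bar>?g x\<bar> \<le> A * (t / 2) powr (- a) * norm (S (t / 2) h)"
      using t by (intro A(2)) auto
    also have "\<dots> \<le> A * (t / 2) powr (- a) * (M1 * norm h)"
      using t A(1) by (intro mult_left_mono S_norm_le_1) auto
    finally show ?thesis .
  qed
  have "H_dir_derivs i (hs @ [h]) (P t f) x = H_dir_derivs i hs (P (t / 2) ?g) x"
    by (simp add: P_half_step[OF t(1) f])
  also have "\<bar>\<dots>\<bar> \<le> K * (t / 2) powr (- c) * prod_list (map norm hs) * (A * (t / 2) powr (- a) * (M1 * norm h))"
    using t f g by (intro K(2) P_H_dir_deriv_bcontfun) auto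
  also have "\<dots> = K * A * M1 * ((t / 2) powr (- c) * (t / 2) powr (- a)) * prod_list (map norm (hs @ [h]))"
    by simp
  also have "(t / 2) powr (- c) * (t / 2) powr (- a) = 2 powr (c + a) * t powr (- (c + a))"
    using t by (simp add: powr_add[symmetric] powr_divide powr_minus field_simps)
  finally show ?thesis by (simp add: mult.assoc)
qed

lemma P_derivs_bound_bounded:
  "\<exists>K\<ge>0. \<forall>t f N hs x. 0 < t \<longrightarrow> t \<le> 1 \<longrightarrow> f \<in> bcontfun \<longrightarrow> (\<forall>x. \<bar>f x\<bar> \<le> N) \<longrightarrow> length hs = k \<longrightarrow>
    \<bar>H_dir_derivs i hs (P t f) x\<bar> \<le> K * t powr (- (real k * \<theta>)) * prod_list (map norm hs) * N"
proof (induction k)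
  case 0
  show ?case using P_bound by (intro exI[of _ 1]) auto
next
  case (Suc k)
  then obtain K where K: "K \<ge> 0" "\<And>t f N hs x. 0 < t \<Longrightarrow> t \<le> 1 \<Longrightarrow> f \<in> bcontfun \<Longrightarrow> (\<And>x. \<bar>f x\<bar> \<le> N)
    \<Longrightarrow> length hs = k \<Longrightarrow>
    \<bar>H_dir_derivs i hs (P t f) x\<bar> \<le> K * t powr (- (real k * \<theta>)) * prod_list (map norm hs) * N"
    by blast
  \<comment> \<open>The factor 2 * (1 + C1) is the first-order bound at \<alpha> = 0; the 2 comes
    from \<open>H_hoelder_0\<close>, and \<open>M1 powr 0 = 1\<close>.\<close>
  define L where "L = K * (2 * (1 + C1)) * M1 * 2 powr (real k * \<theta> + \<theta>)"
  have "\<bar>H_dir_derivs i hs (P t f) x\<bar> \<le> L * t powr (- (real (Suc k) * \<theta>)) * prod_list (map norm hs) * N"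
    if t: "0 < t" "t \<le> 1" and f: "f \<in> bcontfun" "\<And>x. \<bar>f x\<bar> \<le> N" and len: "length hs = Suc k" for t f N hs x
  proof -
    obtain h ks where hs: "hs = ks @ [h]" using len by (metis append_butlast_last_id length_0_conv nat.distinct(1))
    have N: "N \<ge> 0" using f(2)[of 0] by linarith
    have "\<bar>H_dir_derivs i (ks @ [h]) (P t f) x\<bar> \<le> K * (2 * (1 + C1) * N) * M1 * 2 powr (real k * \<theta> + \<theta>)
        * t powr (- (real k * \<theta> + \<theta>)) * prod_list (map norm (ks @ [h]))"
    proof (rule P_derivs_bound_snoc[OF t f(1)])
      show "\<bar>H_dir_deriv i h (P t f) x\<bar> \<le> 2 * (1 + C1) * N * t powr (- \<theta>) * norm h"
        if "0 < t" "t \<le> 1" for t h x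
        using P_H_dir_deriv_bound[OF that H_hoelder_0[OF f], of h x] M1_pos by (simp add: mult_ac)
    qed (use K hs len N C1_pos in auto)
    also have "\<dots> = L * t powr (- (real (Suc k) * \<theta>)) * prod_list (map norm hs) * N"
      by (simp add: L_def hs algebra_simps)
    finally show ?thesis by (simp add: hs)
  qed
  moreover have "L \<ge> 0" using K(1) C1_pos M1_pos by (simp add: L_def)
  ultimately show ?case by blast
qed

text \<open>The exponents k \<theta> of the outer derivatives and (1 - \<alpha>) \<theta> of the
  innermost one add up to (k + 1 - \<alpha>) \<theta>. The summand 1 in the bound takes care of t >
  1.\<close>

lemma P_derivs_bound:
  assumes \<alpha>: "0 \<le> \<alpha>"
  shows "\<exists>K\<ge>0. \<forall>t f N hs x. 0 < t \<longrightarrow> H_hoelder \<alpha> N f \<longrightarrow> length hs = Suc k \<longrightarrow>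
    \<bar>H_dir_derivs i hs (P t f) x\<bar> \<le> K * (1 + t powr (- ((real (Suc k) - \<alpha>) * \<theta>))) * prod_list (map norm hs) * N"
proof -
  obtain K where K: "K \<ge> 0" "\<And>t f N hs x. 0 < t \<Longrightarrow> t \<le> 1 \<Longrightarrow> f \<in> bcontfun \<Longrightarrow> (\<And>x. \<bar>f x\<bar> \<le> N)
    \<Longrightarrow> length hs = k \<Longrightarrow>
    \<bar>H_dir_derivs i hs (P t f) x\<bar> \<le> K * t powr (- (real k * \<theta>)) * prod_list (map norm hs) * N"
    using P_derivs_bound_bounded[of k] by blast
  obtain K' where K': "K' \<ge> 0" "\<And>t f N hs x. 0 < t \<Longrightarrow> t \<le> 1 \<Longrightarrow> f \<in> bcontfun \<Longrightarrow> (\<And>x. \<bar>f x\<bar> \<le> N)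
    \<Longrightarrow> length hs = Suc k \<Longrightarrow>
    \<bar>H_dir_derivs i hs (P t f) x\<bar> \<le> K' * t powr (- (real (Suc k) * \<theta>)) * prod_list (map norm hs) * N"
    using P_derivs_bound_bounded[of "Suc k"] by blast
  define a where "a = (1 - \<alpha>) * \<theta>"
  define A where "A = M1 powr \<alpha> * (1 + C1)"
  define L where "L = K * A * M1 * 2 powr (real k * \<theta> + a)"
  have A: "A \<ge> 0" using C1_pos by (simp add: A_def)
  have L: "L \<ge> 0" using K(1) A M1_pos by (simp add: L_def)
  have "\<bar>H_dir_derivs i hs (P t f) x\<bar> \<le> (L + K') * (1 + t powr (- ((real (Suc k) - \<alpha>) * \<theta>))) * prod_list (map norm hs) * N"
    if t: "0 < t" and f: "H_hoelder \<alpha> N f" and len: "length hs = Suc k" for t f N hs x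
  proof -
    have N: "N \<ge> 0" by (rule H_hoelder_nonneg[OF f])
    note bc = H_hoelder_bcontfun[OF f]
    obtain h ks where hs: "hs = ks @ [h]" using len by (metis append_butlast_last_id length_0_conv nat.distinct(1))
    let ?q = "t powr (- ((real (Suc k) - \<alpha>) * \<theta>))"
    have "\<bar>H_dir_derivs i hs (P t f) x\<bar> \<le> L * ?q * prod_list (map norm hs) * N" if "t \<le> 1"
    proof -
      have "\<bar>H_dir_derivs i (ks @ [h]) (P t f) x\<bar> \<le> K * (A * N) * M1 * 2 powr (real k * \<theta> + a)
          * t powr (- (real k * \<theta> + a)) * prod_list (map norm (ks @ [h]))"
      proof (rule P_derivs_bound_snoc[OF t that bc])
        show "\<bar>H_dir_deriv i h (P t f) x\<bar> \<le> A * N * t powr (- a) * norm h"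
          if "0 < t" "t \<le> 1" for t h x
          using P_H_dir_deriv_bound[OF that f \<alpha>, of h x] by (simp add: A_def a_def mult_ac)
      qed (use K hs len N A in auto)
      also have "real k * \<theta> + a = (real (Suc k) - \<alpha>) * \<theta>"
        by (simp add: a_def algebra_simps)
      finally show ?thesis
        by (simp add: L_def hs mult_ac a_def algebra_simps)
    qed
    \<comment> \<open>For t > 1 only the last unit of time is used for smoothing; over the preceding
      t - 1 the sup norm does not grow, so no factor exp (\<omega> t) appears.\<close>
    moreover have "\<bar>H_dir_derivs i hs (P t f) x\<bar> \<le> K' * 1 * prod_list (map norm hs) * N" if "t > 1"
    proof -
      have "P t f = P 1 (P (t - 1) f)"
        using P_semigroup[of 1 "t - 1" f] that bc by simp
      then show ?thesis
        using K'(2)[of 1 "P (t - 1) f" N hs x] P_bcontfun[of "t - 1" f] P_bound[of "t - 1" f N]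
          that len bc H_hoelder_bound[OF f] by simp
    qed
    moreover have "L * ?q * prod_list (map norm hs) * N \<le> (L + K') * (1 + ?q) * prod_list (map norm hs) * N"
      using L K' N by (intro mult_right_mono mult_mono) auto
    moreover have "K' * 1 * prod_list (map norm hs) * N \<le> (L + K') * (1 + ?q) * prod_list (map norm hs) * N"
      using L K' N by (intro mult_right_mono mult_mono) auto
    ultimately show ?thesis by force
  qed
  moreover have "L + K' \<ge> 0" using L K' by simp
  ultimately show ?thesis by blast
qed

end

section \<open>Differentiation of the resolvent\<close>

text \<open>The half line is open because the estimates on \<open>P\<^sub>t\<close> are only available for \<open>t > 0\<close>.\<close>

abbreviation half_line :: "real measure" where
  "half_line \<equiv> restrict_space lborel {0<..}"

section \<open>Explicit integrals over the half line\<close>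

lemma space_half_line: "space half_line = {0<..}"
  by (simp add: space_restrict_space)

text \<open>Nonnegativity makes the gauge integral absolute, so closed formulas stated with
  \<open>has_integral\<close> become Lebesgue integrals. Borel measurability then passes from the
  completed measure to \<open>lborel\<close>.\<close>

lemma lborel_integral_nonneg:
  fixes f :: "real \<Rightarrow> real"
  assumes f: "f \<in> borel_measurable borel" "\<And>x. x \<in> A \<Longrightarrow> 0 \<le> f x"
    and A: "A \<in> sets borel" and I: "(f has_integral I) A"
  shows "integrable lborel (\<lambda>x. indicator A x * f x)" "(\<integral>x. indicator A x * f x \<partial>lborel) = I"
proof -
  have meas: "(\<lambda>x. indicator A x * f x) \<in> borel_measurable lborel"
    using f A by simp
  have "f absolutely_integrable_on A"
    using I f(2) by (intro nonnegative_absolutely_integrable_1) auto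
  then show "integrable lborel (\<lambda>x. indicator A x * f x)"
    using meas by (simp add: set_integrable_def integrable_completion)
  have "(LINT x:A|lebesgue. f x) = I"
    using set_lebesgue_integral_eq_integral(2)[OF \<open>f absolutely_integrable_on A\<close>] I
    by (simp add: integral_unique)
  then show "(\<integral>x. indicator A x * f x \<partial>lborel) = I"
    using integral_completion[OF meas] by (simp add: set_lebesgue_integral_def)
qed

lemma half_line_weight_integrable:
  assumes lam: "lam > 0" and p: "0 \<le> p" "p < 1"
  shows "integrable half_line (\<lambda>t. exp (- lam * t) * (1 + t powr (- p)))"
proof -
  \<comment> \<open>The majorant uses t powr (- p) on [0, 1], integrable because p < 1, and the
    exponential beyond; the factors 2 leave room for both summands of the weight.\<close>
  have "integrable lborel (\<lambda>t. 2 * (indicator {0..1} t * t powr (- p)) + 2 * (indicator {0..} t * exp (- lam * t)))"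
    using has_integral_powr_from_0[of "- p" 1] has_integral_exp_minus_to_infinity[OF lam, of 0] p
    by (intro Bochner_Integration.integrable_add integrable_mult_right lborel_integral_nonneg(1)) auto
  then have "integrable lborel (\<lambda>t. indicator {0<..} t *\<^sub>R (exp (- lam * t) * (1 + t powr (- p))))"
  proof (rule Bochner_Integration.integrable_bound)
    have "norm (indicator {0<..} t *\<^sub>R (exp (- lam * t) * (1 + t powr (- p)))) \<le>
      norm (2 * (indicator {0..1} t * t powr (- p)) + 2 * (indicator {0..} t * exp (- lam * t)))" for t
    proof (cases "t > 0")
      case True
      have "exp (- lam * t) * t powr (- p) \<le> indicator {0..1} t * t powr (- p) + exp (- lam * t)"
      proof (cases "t \<le> 1")
        case True
        then have "exp (- lam * t) * t powr (- p) \<le> 1 * t powr (- p)"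
          using \<open>t > 0\<close> lam by (intro mult_right_mono) auto
        then show ?thesis using True \<open>t > 0\<close> by (simp add: add_increasing2)
      next
        case False
        have "t powr (- p) \<le> t powr 0"
          using False p by (intro powr_mono) auto
        then have "exp (- lam * t) * t powr (- p) \<le> exp (- lam * t) * 1"
          using False by (intro mult_left_mono) auto
        then show ?thesis using False by simp
      qed
      moreover have "0 \<le> exp (- lam * t) * t powr (- p)" "0 \<le> indicator {0..1} t * t powr (- p)"
        "exp (- lam * t) \<ge> 0"
        by auto
      ultimately have "exp (- lam * t) * (1 + t powr (- p)) \<le>
          2 * (indicator {0..1} t * t powr (- p)) + 2 * exp (- lam * t)"
        unfolding distrib_left mult_1_right by linarith
      then show ?thesis
        using True by (simp add: abs_mult)
    qed simp
    then show "AE t in lborel. norm (indicator {0<..} t *\<^sub>R (exp (- lam * t) * (1 + t powr (- p)))) \<le>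
      norm (2 * (indicator {0..1} t * t powr (- p)) + 2 * (indicator {0..} t * exp (- lam * t)))"
      by (intro AE_I2)
  qed simp
  then show ?thesis
    by (subst integrable_restrict_space) auto
qed

text \<open>Exponential decay absorbs the summand 1: x \<le> exp x at x = \<open>lam\<close> t / q
  gives exp (- \<open>lam\<close> t) t^q \<le> (q / \<open>lam\<close>)^q, and exp (-
  \<open>lam\<close> t) \<le> 1 supplies the +1 in K. A pure power of t is wanted so that splitting
  the integral yields pure powers of the splitting time.\<close>

lemma exp_weight_le_powr:
  fixes lam q :: real
  assumes lam: "lam > 0" and q: "q > 0"
  obtains K where "K > 0" "\<And>t. t > 0 \<Longrightarrow> exp (- lam * t) * (1 + t powr (- q)) \<le> K * t powr (- q)"
proof
  define K where "K = (q / lam) powr q + 1"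
  show "K > 0" using add_nonneg_pos[of "(q / lam) powr q" 1] by (simp add: K_def)
  fix t :: real assume t: "t > 0"
  have "lam * t / q \<le> exp (lam * t / q)"
    using exp_ge_add_one_self[of "lam * t / q"] by linarith
  then have "(lam * t / q) powr q \<le> exp (lam * t / q) powr q"
    using lam q t by (intro powr_mono2) auto
  also have "\<dots> = exp (lam * t)"
    using q by (simp add: exp_powr_real)
  finally have *: "(lam * t / q) powr q \<le> exp (lam * t)" .
  have "t powr q = (q / lam) powr q * (lam * t / q) powr q"
    using lam q t by (subst powr_mult[symmetric]) auto
  also have "\<dots> \<le> (q / lam) powr q * exp (lam * t)"
    using * by (intro mult_left_mono) auto
  finally have "exp (- lam * t) * t powr q \<le> (q / lam) powr q"
    by (simp add: exp_minus field_simps)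
  moreover have "exp (- lam * t) \<le> 1" using lam t by simp
  ultimately have "exp (- lam * t) * t powr q + exp (- lam * t) \<le> K"
    unfolding K_def by (rule add_mono)
  then have "(exp (- lam * t) * t powr q + exp (- lam * t)) * t powr (- q) \<le> K * t powr (- q)"
    by (intro mult_right_mono) auto
  then show "exp (- lam * t) * (1 + t powr (- q)) \<le> K * t powr (- q)"
    using t by (simp add: powr_minus field_simps)
qed

text \<open>The condition p < 1 makes the part near 0 finite and q > 1 the part near infinity; the
  two summands are the exact integrals of the powers on either side of a.\<close>

lemma split_weight_integral:
  fixes g :: "real \<Rightarrow> real"
  assumes a: "a > 0" and p: "p < 1" and q: "q > 1" and AB: "A \<ge> 0" "B \<ge> 0"
    and g: "integrable half_line g"
    and le: "\<And>t. 0 < t \<Longrightarrow> t \<le> a \<Longrightarrow> \<bar>g t\<bar> \<le> A * t powr (- p)"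
      "\<And>t. a < t \<Longrightarrow> \<bar>g t\<bar> \<le> B * t powr (- q)"
  shows "\<bar>\<integral>t. g t \<partial>half_line\<bar> \<le> A * (a powr (1 - p) / (1 - p)) + B * (a powr (1 - q) / (q - 1))"
proof -
  have "((\<lambda>t. t powr (- p)) has_integral a powr (1 - p) / (1 - p)) {0..a}"
    using has_integral_powr_from_0[of "- p" a] a p by simp
  note 1 = lborel_integral_nonneg[OF _ _ _ this, simplified]
  have "((\<lambda>t. t powr (- q)) has_integral a powr (1 - q) / (q - 1)) {a..}"
    using has_integral_powr_to_inf[of "- q" a] a q
    by (simp add: minus_divide_right)
  note 2 = lborel_integral_nonneg[OF _ _ _ this, simplified]
  have "\<bar>\<integral>t. g t \<partial>half_line\<bar> = \<bar>\<integral>t. indicator {0<..} t * g t \<partial>lborel\<bar>"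
    by (subst integral_restrict_space) auto
  also have "\<dots> \<le> (\<integral>t. A * (indicator {0..a} t * t powr (- p)) + B * (indicator {a..} t * t powr (- q)) \<partial>lborel)"
  proof (rule abs_integral_le)
    show "integrable lborel (\<lambda>t. indicator {0<..} t * g t)"
      using g by (subst (asm) integrable_restrict_space) auto
    show "integrable lborel (\<lambda>t. A * (indicator {0..a} t * t powr (- p)) + B * (indicator {a..} t * t powr (- q)))"
      using 1(1) 2(1) by (intro Bochner_Integration.integrable_add integrable_mult_right)
    show "\<bar>indicator {0<..} t * g t\<bar> \<le> A * (indicator {0..a} t * t powr (- p)) + B * (indicator {a..} t * t powr (- q))" for t
      using le[of t] AB by (auto simp: indicator_def intro: add_increasing2)
  qed
  also have "\<dots> = A * (a powr (1 - p) / (1 - p)) + B * (a powr (1 - q) / (q - 1))"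
    using 1 2 by simp
  finally show ?thesis .
qed

section \<open>Measurability in time and differentiation under the Laplace integral\<close>

context mehler_semigroup
begin

text \<open>Time enters both the measure and the point T_t x. With the point frozen, weak continuity
  of \<mu> gives measurability. The point is then approximated through the grid times
  \<open>\<lfloor>t * (n + 1)\<rfloor> / (n + 1)\<close>; strong continuity of T and continuity of
  \<open>G t\<close> give the limit.\<close>

lemma P_measurable:
  assumes f: "f \<in> bcontfun"
  shows "(\<lambda>t. P t f x) \<in> borel_measurable (restrict_space borel {0..})"
proof -
  define G where "G t z = (\<integral>y. f (z + y) \<partial>\<mu> t)" for t z
  define m where "m n t = nat \<lfloor>t * real (Suc n)\<rfloor>" for n t
  have G_meas: "(\<lambda>t. G t z) \<in> borel_measurable (restrict_space borel {0..})" for z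
    using measures translate_bcontfun[OF f, of z] unfolding G_def mehler_measures_def
    by (intro borel_measurable_continuous_on_restrict) auto
  show ?thesis
  proof (rule borel_measurable_LIMSEQ_real)
    show "(\<lambda>t. G t (T (real (m n t) / real (Suc n)) x)) \<in> borel_measurable (restrict_space borel {0..})" for n
    \<comment> \<open>For each of the countably many values j of \<open>m n\<close>, the point T (j
      / (n + 1)) x is fixed, so \<open>G_meas\<close> applies.\<close>
    proof (rule measurable_compose_countable[where g="m n" and f="\<lambda>j t. G t (T (real j / real (Suc n)) x)"])
      show "m n \<in> restrict_space borel {0..} \<rightarrow>\<^sub>M count_space UNIV"
        unfolding m_def by (intro measurable_restrict_space1) measurable
    qed (rule G_meas)
    fix t :: real assume "t \<in> space (restrict_space borel {0..})"
    then have t: "t \<ge> 0" by (simp add: space_restrict_space)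
    have m: "real (m n t) / real (Suc n) \<le> t" "t \<le> real (m n t) / real (Suc n) + inverse (real (Suc n))" for n
    proof -
      have "real (m n t) = of_int \<lfloor>t * real (Suc n)\<rfloor>" using t by (simp add: m_def)
      then have "real (m n t) \<le> t * real (Suc n)" "t * real (Suc n) \<le> real (m n t) + 1"
        by linarith+
      then show "real (m n t) / real (Suc n) \<le> t" "t \<le> real (m n t) / real (Suc n) + inverse (real (Suc n))"
        by (simp_all add: field_simps)
    qed
    have "(\<lambda>n. real (m n t) / real (Suc n)) \<longlonglongrightarrow> t"
    proof (rule tendsto_sandwich[where f="\<lambda>n. t - inverse (real (Suc n))" and h="\<lambda>_. t"])
      have "(\<lambda>n. t - inverse (real (Suc n))) \<longlonglongrightarrow> t - 0"
        by (intro tendsto_intros LIMSEQ_inverse_real_of_nat)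
      then show "(\<lambda>n. t - inverse (real (Suc n))) \<longlonglongrightarrow> t" by simp
    qed (use m in \<open>auto simp: diff_le_eq simp del: of_nat_Suc\<close>)
    moreover have "continuous_on {0..} (\<lambda>t. T t x)"
      using semigroup by (simp add: strongly_continuous_semigroup_def)
    ultimately have "(\<lambda>n. T (real (m n t) / real (Suc n)) x) \<longlonglongrightarrow> T t x"
      using t unfolding continuous_on_sequentially by (auto simp: comp_def)
    moreover have "integrable (\<mu> t) (\<lambda>_. 1 :: real)"
      by (rule finite_measure.integrable_const[OF prob_space.finite_measure[OF prob_mu[OF t]]])
    then have "continuous_on UNIV (G t)"
      using translate_integral_continuous[OF t f, of "\<lambda>_. 1"] by (simp add: G_def[abs_def])
    ultimately show "(\<lambda>n. G t (T (real (m n t) / real (Suc n)) x)) \<longlonglongrightarrow> P t f x"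
      unfolding continuous_on_sequentially by (auto simp: comp_def mehler_def G_def)
  qed
qed

text \<open>Each further derivative is a limit of difference quotients along the countable sequence
  1 / (n + 1), so measurability in t is inherited by induction.\<close>

lemma P_derivs_measurable:
  assumes f: "f \<in> bcontfun"
  shows "(\<lambda>t. H_dir_derivs i hs (P t f) x) \<in> borel_measurable half_line"
proof (induction hs arbitrary: x)
  case Nil
  have "(\<lambda>t. P t f x) \<in> borel_measurable (restrict_space (restrict_space borel {0..}) {0<..})"
    by (intro measurable_restrict_space1 P_measurable f)
  moreover have "({0..} \<inter> {0<..} :: real set) = {0<..}" by auto
  ultimately have "(\<lambda>t. P t f x) \<in> borel_measurable (restrict_space borel {0<..})"
    by (simp add: restrict_restrict_space)
  then show ?case
    by (subst measurable_cong_sets[of _ "restrict_space borel {0<..}"]) (auto simp: sets_restrict_space)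
next
  case (Cons h hs)
  have s: "real (Suc n) \<noteq> 0" for n by simp
  show ?case
  proof (rule borel_measurable_LIMSEQ_real)
    show "(\<lambda>t. (H_dir_derivs i hs (P t f) (x + inverse (real (Suc n)) *\<^sub>R i h) - H_dir_derivs i hs (P t f) x)
        / inverse (real (Suc n))) \<in> borel_measurable half_line" for n
      by (intro borel_measurable_divide borel_measurable_diff Cons.IH) auto
    fix t assume "t \<in> space half_line"
    then have "H_differentiable i (H_dir_derivs i hs (P t f))"
      using P_smooth[of t f hs] f by (simp add: space_restrict_space)
    from H_differentiable_has_derivative[OF this, of x h 0]
    show "(\<lambda>n. (H_dir_derivs i hs (P t f) (x + inverse (real (Suc n)) *\<^sub>R i h) - H_dir_derivs i hs (P t f) x)
        / inverse (real (Suc n))) \<longlonglongrightarrow> H_dir_derivs i (h # hs) (P t f) x"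
      using LIMSEQ_inverse_real_of_nat
      unfolding DERIV_def tendsto_at_iff_sequentially by (auto simp: comp_def simp del: of_nat_Suc)
  qed
qed

lemma resolvent_eq:
  assumes f: "f \<in> bcontfun"
  shows "mehler_resolvent T \<mu> lam f x = (\<integral>t. exp (- lam * t) * P t f x \<partial>half_line)"
proof -
  have "mehler_resolvent T \<mu> lam f x = (LINT t:{0<..}|lborel. exp (- lam * t) * P t f x)"
    unfolding mehler_resolvent_def by (rule set_integral_discrete_difference[where X="{0}"]) auto
  then show ?thesis
    by (subst integral_restrict_space) (auto simp: set_lebesgue_integral_def)
qed

definition deriv_kernel :: "real \<Rightarrow> ('a \<Rightarrow> real) \<Rightarrow> 'h list \<Rightarrow> 'a \<Rightarrow> real \<Rightarrow> real" where
  "deriv_kernel lam f hs x t = exp (- lam * t) * H_dir_derivs i hs (P t f) x"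

lemma deriv_kernel_measurable: "f \<in> bcontfun \<Longrightarrow> deriv_kernel lam f hs x \<in> borel_measurable half_line"
  unfolding deriv_kernel_def
  by (intro borel_measurable_times P_derivs_measurable measurable_restrict_space1) auto

text \<open>The dominating functions may depend on the directions but not on x. The one for
  \<open>h # hs\<close> lets the integral for \<open>hs\<close> be differentiated along h; the one
  for \<open>hs\<close> itself gives integrability and continuity in x.\<close>

lemma resolvent_derivs:
  fixes n :: nat
  assumes f: "f \<in> bcontfun"
    and w: "\<And>hs. length hs \<le> n \<Longrightarrow> integrable half_line (w hs)"
      "\<And>hs x t. length hs \<le> n \<Longrightarrow> t > 0 \<Longrightarrow> \<bar>deriv_kernel lam f hs x t\<bar> \<le> w hs t"
  shows "H_smooth i n (mehler_resolvent T \<mu> lam f)"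
    and "\<And>hs x. length hs \<le> n \<Longrightarrow>
      H_dir_derivs i hs (mehler_resolvent T \<mu> lam f) x = (\<integral>t. deriv_kernel lam f hs x t \<partial>half_line)"
    and "\<And>hs x. length hs \<le> n \<Longrightarrow> integrable half_line (deriv_kernel lam f hs x)"
proof -
  let ?u = "mehler_resolvent T \<mu> lam f"
  show int: "integrable half_line (deriv_kernel lam f hs x)" if "length hs \<le> n" for hs x
    by (rule Bochner_Integration.integrable_bound[OF w(1)[OF that] deriv_kernel_measurable[OF f]])
       (use w(2)[OF that, of _ x] in \<open>auto simp: space_half_line intro!: AE_I2 order_trans[OF _ abs_ge_self]\<close>)
  have der: "((\<lambda>r. \<integral>t. deriv_kernel lam f hs (x + r *\<^sub>R i h) t \<partial>half_line) has_real_derivative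
      (\<integral>t. deriv_kernel lam f (h # hs) x t \<partial>half_line)) (at 0)" if "length hs < n" for hs x h
  proof -
    have "((\<lambda>r. \<integral>t. deriv_kernel lam f hs (x + r *\<^sub>R i h) t \<partial>half_line) has_real_derivative
      (\<integral>t. deriv_kernel lam f (h # hs) (x + 0 *\<^sub>R i h) t \<partial>half_line)) (at 0)"
    proof (rule has_real_derivative_integral[where w="w (h # hs)"])
      fix r t assume "t \<in> space half_line"
      then have "t > 0" by (simp add: space_half_line)
      then have "H_differentiable i (H_dir_derivs i hs (P t f))"
        using P_smooth f by blast
      from H_differentiable_has_derivative[OF this, of x h r]
      show "((\<lambda>r. deriv_kernel lam f hs (x + r *\<^sub>R i h) t) has_real_derivative
          deriv_kernel lam f (h # hs) (x + r *\<^sub>R i h) t) (at r)"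
        unfolding deriv_kernel_def by (simp add: DERIV_cmult)
      show "\<bar>deriv_kernel lam f (h # hs) (x + r *\<^sub>R i h) t\<bar> \<le> w (h # hs) t"
        using w(2)[of "h # hs"] that \<open>t > 0\<close> by simp
    qed (use that int w(1)[of "h # hs"] in auto)
    then show ?thesis by simp
  qed
  show eq: "H_dir_derivs i hs ?u x = (\<integral>t. deriv_kernel lam f hs x t \<partial>half_line)" if "length hs \<le> n" for hs x
    using that
  proof (induction hs arbitrary: x)
    case Nil
    show ?case using resolvent_eq[OF f] by (simp add: deriv_kernel_def)
  next
    case (Cons h hs)
    then show ?case
      using der[of hs x h] by (auto intro!: H_dir_derivI)
  qed
  show "H_smooth i n ?u"
    unfolding H_smooth_def
  proof (intro conjI allI impI)
    fix hs :: "'h list" assume hs: "length hs < n"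
    show "H_differentiable i (H_dir_derivs i hs ?u)"
      using der[OF hs] by (intro H_differentiableI) (simp add: eq less_imp_le[OF hs])
  next
    fix hs :: "'h list" assume hs: "length hs \<le> n"
    have "continuous_on UNIV (\<lambda>x. \<integral>t. deriv_kernel lam f hs x t \<partial>half_line)"
    proof (rule continuous_on_integral_dominated[where w="w hs"])
      show "continuous_on UNIV (\<lambda>x. deriv_kernel lam f hs x t)" if "t \<in> space half_line" for t
        using P_smooth[of t f hs] f that bcontfun_continuous unfolding deriv_kernel_def
        by (intro continuous_intros) (auto simp: space_half_line)
    qed (use w hs deriv_kernel_measurable[OF f] in \<open>auto simp: space_half_line\<close>)
    then show "continuous_on UNIV (H_dir_derivs i hs ?u)"
      using eq[OF hs] by presburger
  qed
qed

text \<open>The hypothesis on k is (k - \<alpha>) \<theta> < 1, which makes the singularity at time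
  0 integrable. The first estimate supplies the dominating weight, the second a pure power for the
  splitting. The second requires k > 0: at k = 0 and \<alpha> > 0 its right side would vanish as t
  tends to 0.\<close>

lemma deriv_kernel_bound:
  assumes \<alpha>: "0 \<le> \<alpha>" "\<alpha> < 1" and k: "real k < \<alpha> + 1 / \<theta>" and lam: "lam > 0"
  obtains K w where "K \<ge> 0" "integrable half_line w"
    "\<And>f N hs x t. H_hoelder \<alpha> N f \<Longrightarrow> length hs = k \<Longrightarrow> t > 0 \<Longrightarrow>
      \<bar>deriv_kernel lam f hs x t\<bar> \<le> w t * (prod_list (map norm hs) * N)"
    "\<And>f N hs x t. k > 0 \<Longrightarrow> H_hoelder \<alpha> N f \<Longrightarrow> length hs = k \<Longrightarrow> t > 0 \<Longrightarrow>
      \<bar>deriv_kernel lam f hs x t\<bar> \<le> K * t powr (- ((real k - \<alpha>) * \<theta>)) * prod_list (map norm hs) * N"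
proof (cases k)
  case 0
  show thesis
  \<comment> \<open>Here \<open>t powr (- 0) = 1\<close> for t > 0, so the weight is 2 exp (-
    \<open>lam\<close> t), written so that the general integrability lemma applies with p =
    0.\<close>
  proof (rule that[of 0 "\<lambda>t. exp (- lam * t) * (1 + t powr (- 0))"])
    show "integrable half_line (\<lambda>t. exp (- lam * t) * (1 + t powr (- 0)))"
      by (rule half_line_weight_integrable) (use lam in auto)
    fix f N hs x t
    assume f: "H_hoelder \<alpha> N f" and "length (hs :: 'h list) = k" and t: "(t::real) > 0"
    then have hs: "hs = []" using 0 by simp
    have "\<bar>P t f x\<bar> \<le> N"
      using t H_hoelder_bcontfun[OF f] H_hoelder_bound[OF f] by (intro P_bound) auto
    then have "exp (- lam * t) * \<bar>P t f x\<bar> \<le> exp (- lam * t) * (2 * N)"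
      using H_hoelder_nonneg[OF f] by (intro mult_left_mono) auto
    then show "\<bar>deriv_kernel lam f hs x t\<bar> \<le> exp (- lam * t) * (1 + t powr (- 0)) * (prod_list (map norm hs) * N)"
      using t by (simp add: hs deriv_kernel_def abs_mult)
  qed (use 0 in auto)
next
  case (Suc l)
  define p where "p = (real k - \<alpha>) * \<theta>"
  have p: "0 < p" using \<alpha> \<theta>_pos Suc by (auto simp: p_def)
  have p1: "p < 1" using k \<theta>_pos by (simp add: p_def field_simps)
  obtain L where L: "L \<ge> 0" "\<And>t f N hs x. 0 < t \<Longrightarrow> H_hoelder \<alpha> N f \<Longrightarrow> length hs = k \<Longrightarrow>
    \<bar>H_dir_derivs i hs (P t f) x\<bar> \<le> L * (1 + t powr (- p)) * prod_list (map norm hs) * N"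
    using P_derivs_bound[OF \<alpha>(1), of l] unfolding p_def Suc by blast
  obtain J where J: "J > 0" "\<And>t. t > 0 \<Longrightarrow> exp (- lam * t) * (1 + t powr (- p)) \<le> J * t powr (- p)"
    by (rule exp_weight_le_powr[OF lam p]) blast
  have le: "\<bar>deriv_kernel lam f hs x t\<bar> \<le> L * (exp (- lam * t) * (1 + t powr (- p))) * (prod_list (map norm hs) * N)"
    if "H_hoelder \<alpha> N f" "length hs = k" "t > 0" for f N hs x t
    using mult_left_mono[OF L(2)[OF that(3,1,2), of x], of "exp (- lam * t)"]
    by (simp add: deriv_kernel_def abs_mult mult_ac)
  show thesis
  proof (rule that[of "L * J" "\<lambda>t. L * (exp (- lam * t) * (1 + t powr (- p)))"])
    show "integrable half_line (\<lambda>t. L * (exp (- lam * t) * (1 + t powr (- p))))"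
      using lam p p1 by (intro integrable_mult_right half_line_weight_integrable) auto
    show "\<bar>deriv_kernel lam f hs x t\<bar> \<le> L * J * t powr (- ((real k - \<alpha>) * \<theta>)) * prod_list (map norm hs) * N"
      if f: "H_hoelder \<alpha> N f" and "length hs = k" "t > 0" for f N hs x t
    proof -
      have "L * (exp (- lam * t) * (1 + t powr (- p))) * (prod_list (map norm hs) * N)
          \<le> L * (J * t powr (- p)) * (prod_list (map norm hs) * N)"
        using J(2)[OF that(3)] L(1) H_hoelder_nonneg[OF f] by (intro mult_right_mono mult_left_mono) auto
      then show ?thesis using le[OF that, of x] by (simp add: p_def mult_ac)
    qed
  qed (use le L J in auto)
qed

end

section \<open>Hoelder regularity of the resolvent\<close>

context mehler_semigroup
begin

text \<open>For t \<le> 1 the increment is controlled through \<open>S t h\<close>. For t > 1 the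
  restriction on t forces norm h \<ge> 1, so the trivial bound 2 N is already at most 2 N
  \<open>norm h powr \<alpha>\<close>. The two cases account for the two summands of the
  constant.\<close>

lemma P_increment:
  assumes \<alpha>: "0 \<le> \<alpha>"
  obtains K where "K \<ge> 0" "\<And>f N x h t. H_hoelder \<alpha> N f \<Longrightarrow> 0 < t \<Longrightarrow> t \<le> norm h powr (1 / \<theta>) \<Longrightarrow>
    \<bar>P t f (x + i h) - P t f x\<bar> \<le> K * norm h powr \<alpha> * N"
proof (rule that)
  show "0 \<le> M1 powr \<alpha> + 2" using M1_pos by (simp add: add_nonneg_nonneg)
  fix f N x t and h :: 'h
  assume f: "H_hoelder \<alpha> N f" and t: "0 < t" "t \<le> norm h powr (1 / \<theta>)"
  note N = H_hoelder_nonneg[OF f]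
  show "\<bar>P t f (x + i h) - P t f x\<bar> \<le> (M1 powr \<alpha> + 2) * norm h powr \<alpha> * N"
  proof (cases "t \<le> 1")
    case True
    have "norm (S t h) powr \<alpha> \<le> (M1 * norm h) powr \<alpha>"
      using S_norm_le_1[OF t(1) True] \<alpha> by (intro powr_mono2) auto
    then have "N * norm (S t h) powr \<alpha> \<le> N * (M1 powr \<alpha> * norm h powr \<alpha>)"
      using N M1_pos by (intro mult_left_mono) (auto simp: powr_mult)
    then have "\<bar>P t f (x + i h) - P t f x\<bar> \<le> M1 powr \<alpha> * norm h powr \<alpha> * N"
      using P_H_difference[OF t(1) f, of x h] by (simp add: mult_ac)
    also have "\<dots> \<le> (M1 powr \<alpha> + 2) * norm h powr \<alpha> * N"
      using N by (intro mult_right_mono) auto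
    finally show ?thesis .
  next
    case False
    have "norm h \<ge> 1"
    proof (rule ccontr)
      assume "\<not> norm h \<ge> 1"
      then have "norm h powr (1 / \<theta>) \<le> 1" using \<theta>_pos by (intro powr_le1) auto
      then show False using t False by linarith
    qed
    then have h: "1 \<le> norm h powr \<alpha>" using \<alpha> by (rule ge_one_powr_ge_zero)
    have P: "\<bar>P t f y\<bar> \<le> N" for y
      using t H_hoelder_bcontfun[OF f] H_hoelder_bound[OF f] by (intro P_bound) auto
    have "\<bar>P t f (x + i h) - P t f x\<bar> \<le> 2 * 1 * N"
      using P[of x] P[of "x + i h"] by linarith
    also have "\<dots> \<le> (M1 powr \<alpha> + 2) * norm h powr \<alpha> * N"
      using h N by (intro mult_right_mono mult_mono) auto
    finally show ?thesis .
  qed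
qed

text \<open>The pair (b, p) is (\<alpha>, 0) for k = 0 and (0, (k - \<alpha>) \<theta>) otherwise.
  The equation relating them says that integrating the bound up to t =
  \<open>norm h powr (1 / \<theta>)\<close> produces exactly the power
  \<open>norm h powr (\<alpha> + 1 / \<theta> - k)\<close> in both cases.\<close>

lemma deriv_kernel_increment:
  assumes \<alpha>: "0 \<le> \<alpha>" "\<alpha> < 1" and k: "real k < \<alpha> + 1 / \<theta>" and lam: "lam > 0"
  obtains K b p where "K \<ge> 0" "p < 1" "b + (1 - p) / \<theta> = \<alpha> + 1 / \<theta> - real k"
    "\<And>f N hs x h t. H_hoelder \<alpha> N f \<Longrightarrow> length hs = k \<Longrightarrow> 0 < t \<Longrightarrow> t \<le> norm h powr (1 / \<theta>) \<Longrightarrow>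
      \<bar>deriv_kernel lam f hs (x + i h) t - deriv_kernel lam f hs x t\<bar> \<le>
      K * norm h powr b * prod_list (map norm hs) * N * t powr (- p)"
proof (cases "k = 0")
  case True
  obtain K where K: "K \<ge> 0" "\<And>f N x h t. H_hoelder \<alpha> N f \<Longrightarrow> 0 < t \<Longrightarrow> t \<le> norm h powr (1 / \<theta>) \<Longrightarrow>
    \<bar>P t f (x + i h) - P t f x\<bar> \<le> K * norm h powr \<alpha> * N"
    by (rule P_increment[OF \<alpha>(1)]) blast
  show thesis
  proof (rule that[of K 0 \<alpha>])
    fix f N x t and h :: 'h and hs :: "'h list"
    assume *: "H_hoelder \<alpha> N f" "length hs = k" "0 < t" "t \<le> norm h powr (1 / \<theta>)"
    have "exp (- lam * t) * \<bar>P t f (x + i h) - P t f x\<bar> \<le> 1 * (K * norm h powr \<alpha> * N)"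
      using K(2)[OF *(1,3,4), of x] * lam by (intro mult_mono) auto
    then show "\<bar>deriv_kernel lam f hs (x + i h) t - deriv_kernel lam f hs x t\<bar> \<le>
      K * norm h powr \<alpha> * prod_list (map norm hs) * N * t powr (- 0)"
      using * True by (simp add: deriv_kernel_def abs_mult flip: right_diff_distrib)
  qed (use K True in auto)
next
  case False
  obtain K where K: "K \<ge> 0" "\<And>f N hs x t. H_hoelder \<alpha> N f \<Longrightarrow> length hs = k \<Longrightarrow> t > 0 \<Longrightarrow>
      \<bar>deriv_kernel lam f hs x t\<bar> \<le> K * t powr (- ((real k - \<alpha>) * \<theta>)) * prod_list (map norm hs) * N"
    by (rule deriv_kernel_bound[OF assms]) (use False in blast)
  show thesis
  proof (rule that[of "2 * K" "(real k - \<alpha>) * \<theta>" 0])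
    show "(real k - \<alpha>) * \<theta> < 1" using k \<theta>_pos by (simp add: field_simps)
    show "0 + (1 - (real k - \<alpha>) * \<theta>) / \<theta> = \<alpha> + 1 / \<theta> - real k"
      using \<theta>_pos by (simp add: field_simps)
    fix f N x t and h :: 'h and hs :: "'h list"
    assume *: "H_hoelder \<alpha> N f" "length hs = k" "0 < t" "t \<le> norm h powr (1 / \<theta>)"
    \<comment> \<open>At h = 0 the upper limit for t is 0, contradicting t > 0. Thus
      \<open>norm h powr 0\<close> is 1 here rather than the default 0.\<close>
    then have "h \<noteq> 0" by auto
    then show "\<bar>deriv_kernel lam f hs (x + i h) t - deriv_kernel lam f hs x t\<bar> \<le>
      2 * K * norm h powr 0 * prod_list (map norm hs) * N * t powr (- ((real k - \<alpha>) * \<theta>))"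
      using K(2)[OF *(1-3), of x] K(2)[OF *(1-3), of "x + i h"] by (simp add: mult_ac)
  qed (use K in auto)
qed

text \<open>The two bounds on n are p < 1 (when n > 0) and q > 1 for the exponents on the two sides
  of the splitting time. Integrability of the kernels, supplied later by
  \<open>resolvent_derivs\<close>, turns the difference of integrals into the integral of
  increments.\<close>

lemma resolvent_hoelder:
  assumes \<alpha>: "0 \<le> \<alpha>" "\<alpha> < 1" and n: "real n < \<alpha> + 1 / \<theta>" "\<alpha> + 1 / \<theta> < real n + 1" and lam: "lam > 0"
  shows "\<exists>K\<ge>0. \<forall>f N hs x h. H_hoelder \<alpha> N f \<longrightarrow> length hs = n \<longrightarrow>
    (\<forall>x. integrable half_line (deriv_kernel lam f hs x)) \<longrightarrow>
    \<bar>(\<integral>t. deriv_kernel lam f hs (x + i h) t \<partial>half_line) - (\<integral>t. deriv_kernel lam f hs x t \<partial>half_line)\<bar>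
      \<le> K * N * norm h powr (\<alpha> + 1 / \<theta> - real n) * prod_list (map norm hs)"
proof -
  define \<sigma> where "\<sigma> = \<alpha> + 1 / \<theta> - real n"
  obtain K b p where K: "K \<ge> 0" "p < 1" "b + (1 - p) / \<theta> = \<sigma>"
    "\<And>f N hs x h t. H_hoelder \<alpha> N f \<Longrightarrow> length hs = n \<Longrightarrow> 0 < t \<Longrightarrow> t \<le> norm h powr (1 / \<theta>) \<Longrightarrow>
      \<bar>deriv_kernel lam f hs (x + i h) t - deriv_kernel lam f hs x t\<bar> \<le>
      K * norm h powr b * prod_list (map norm hs) * N * t powr (- p)"
    unfolding \<sigma>_def by (rule deriv_kernel_increment[OF \<alpha> n(1) lam]) blast
  \<comment> \<open>This is the exponent of order n + 1. That q > 1 restates \<alpha> + 1/\<theta> <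
    n + 1, and the second identity makes the long-time part scale like the short-time part.\<close>
  define q where "q = (real (Suc n) - \<alpha>) * \<theta>"
  have q: "q > 1" "1 + (1 - q) / \<theta> = \<sigma>"
    using n \<theta>_pos by (simp_all add: q_def \<sigma>_def field_simps)
  obtain L0 where L0: "L0 \<ge> 0" "\<And>t f N hs x. 0 < t \<Longrightarrow> H_hoelder \<alpha> N f \<Longrightarrow> length hs = Suc n \<Longrightarrow>
    \<bar>H_dir_derivs i hs (P t f) x\<bar> \<le> L0 * (1 + t powr (- q)) * prod_list (map norm hs) * N"
    using P_derivs_bound[OF \<alpha>(1), of n] unfolding q_def by blast
  obtain J where J: "J > 0" "\<And>t. t > 0 \<Longrightarrow> exp (- lam * t) * (1 + t powr (- q)) \<le> J * t powr (- q)"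
    by (rule exp_weight_le_powr[OF lam, of q]) (use q in auto)
  have far: "\<bar>deriv_kernel lam f hs (x + i h) t - deriv_kernel lam f hs x t\<bar> \<le>
      L0 * J * norm h * prod_list (map norm hs) * N * t powr (- q)"
    if f: "H_hoelder \<alpha> N f" and "length hs = n" and t: "0 < t" for f N hs x h t
  proof -
    have "\<bar>H_dir_derivs i hs (P t f) (x + i h) - H_dir_derivs i hs (P t f) x\<bar>
        \<le> L0 * (1 + t powr (- q)) * prod_list (map norm (h # hs)) * N"
    proof (rule H_difference_le)
      show "H_differentiable i (H_dir_derivs i hs (P t f))"
        using P_smooth[OF t H_hoelder_bcontfun[OF f]] by blast
    qed (use L0(2)[OF t f, of "h # hs"] that in auto)
    then have "exp (- lam * t) * \<bar>H_dir_derivs i hs (P t f) (x + i h) - H_dir_derivs i hs (P t f) x\<bar>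
        \<le> exp (- lam * t) * (L0 * (1 + t powr (- q)) * prod_list (map norm (h # hs)) * N)"
      by (rule mult_left_mono) simp
    also have "\<dots> = (exp (- lam * t) * (1 + t powr (- q))) * (L0 * prod_list (map norm (h # hs)) * N)"
      by simp
    also have "\<dots> \<le> (J * t powr (- q)) * (L0 * prod_list (map norm (h # hs)) * N)"
      using H_hoelder_nonneg[OF f] L0(1) by (intro mult_right_mono J(2) t) (auto intro!: mult_nonneg_nonneg)
    finally show ?thesis
      by (simp add: deriv_kernel_def abs_mult mult_ac flip: right_diff_distrib)
  qed
  define K' where "K' = K / (1 - p) + L0 * J / (q - 1)"
  have "K' \<ge> 0" using K L0 J q by (simp add: K'_def)
  moreover have "\<bar>(\<integral>t. deriv_kernel lam f hs (x + i h) t \<partial>half_line) - (\<integral>t. deriv_kernel lam f hs x t \<partial>half_line)\<bar>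
      \<le> K' * N * norm h powr \<sigma> * prod_list (map norm hs)"
    if f: "H_hoelder \<alpha> N f" and len: "length hs = n" and int: "\<And>x. integrable half_line (deriv_kernel lam f hs x)"
    for f N hs x h
  proof (cases "h = 0")
    case False
    define a where "a = norm h powr (1 / \<theta>)"
    define R where "R = prod_list (map norm hs) * N"
    have R: "R \<ge> 0" using H_hoelder_nonneg[OF f] by (simp add: R_def)
    have a: "a > 0" using False by (simp add: a_def)
    have "\<bar>\<integral>t. deriv_kernel lam f hs (x + i h) t - deriv_kernel lam f hs x t \<partial>half_line\<bar> \<le>
        K * norm h powr b * R * (a powr (1 - p) / (1 - p)) + L0 * J * norm h * R * (a powr (1 - q) / (q - 1))"
    proof (rule split_weight_integral[OF a K(2) q(1)])
      show "\<bar>deriv_kernel lam f hs (x + i h) t - deriv_kernel lam f hs x t\<bar> \<le> K * norm h powr b * R * t powr (- p)"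
        if "0 < t" "t \<le> a" for t
        using K(4)[OF f len, of t h x] that by (simp add: a_def R_def mult.assoc)
      show "\<bar>deriv_kernel lam f hs (x + i h) t - deriv_kernel lam f hs x t\<bar> \<le> L0 * J * norm h * R * t powr (- q)"
        if "a < t" for t
        using far[OF f len, of t x h] that a by (simp add: R_def mult.assoc)
    qed (use K L0 J R int in auto)
    \<comment> \<open>With a = \<open>norm h powr (1 / \<theta>)\<close> the exponents b + (1 - p) /
      \<theta> and 1 + (1 - q) / \<theta> both equal \<sigma>. This rewrites the two summands in
      turn.\<close>
    also have "norm h powr b * a powr (1 - p) = norm h powr \<sigma>"
      using False by (simp add: a_def powr_powr powr_add[symmetric] K(3)[symmetric])
    then have "K * norm h powr b * R * (a powr (1 - p) / (1 - p)) = K / (1 - p) * norm h powr \<sigma> * R"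
      by (simp add: mult_ac)
    also have "norm h * a powr (1 - q) = norm h powr 1 * norm h powr ((1 - q) / \<theta>)"
      using False by (simp add: a_def powr_powr)
    then have "norm h * a powr (1 - q) = norm h powr \<sigma>"
      by (simp only: q(2)[symmetric] powr_add)
    then have "L0 * J * norm h * R * (a powr (1 - q) / (q - 1)) = L0 * J / (q - 1) * norm h powr \<sigma> * R"
      by (simp add: mult_ac)
    finally show ?thesis
      using int by (simp add: K'_def R_def algebra_simps)
  qed simp
  ultimately show ?thesis
    unfolding \<sigma>_def by blast
qed

lemma resolvent_regularity:
  assumes \<alpha>: "0 \<le> \<alpha>" "\<alpha> < 1" and s: "\<alpha> + 1 / \<theta> \<notin> \<nat>" and lam: "lam > 0"
  shows "\<exists>K>0. \<forall>f N. H_hoelder \<alpha> N f \<longrightarrow>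
    mehler_resolvent T \<mu> lam f \<in> CH i (\<alpha> + 1 / \<theta>) \<and>
    CH_norm i (\<alpha> + 1 / \<theta>) (mehler_resolvent T \<mu> lam f) \<le> ennreal (K * N)"
proof -
  define n where "n = nat \<lfloor>\<alpha> + 1 / \<theta>\<rfloor>"
  define \<sigma> where "\<sigma> = frac (\<alpha> + 1 / \<theta>)"
  have s0: "\<alpha> + 1 / \<theta> > 0" using \<alpha> \<theta>_pos by (simp add: add_nonneg_pos)
  then have fl: "real n = of_int \<lfloor>\<alpha> + 1 / \<theta>\<rfloor>" by (simp add: n_def)
  then have \<sigma>: "\<sigma> = \<alpha> + 1 / \<theta> - real n" by (simp add: \<sigma>_def frac_def)
  have "real n \<noteq> \<alpha> + 1 / \<theta>" using s by (metis of_nat_in_Nats)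
  then have n: "real n < \<alpha> + 1 / \<theta>" "\<alpha> + 1 / \<theta> < real n + 1"
    using fl by linarith+
  \<comment> \<open>The weight has to be chosen for each order before f, N, \<open>hs\<close> and x,
    so that its integral is a constant independent of f; the predicate fixes this order of
    quantifiers for \<open>choice\<close>.\<close>
  define dominates where "dominates k w \<longleftrightarrow> integrable half_line w \<and> (\<forall>f N hs x t.
      H_hoelder \<alpha> N f \<longrightarrow> length hs = k \<longrightarrow> t > 0 \<longrightarrow>
      \<bar>deriv_kernel lam f hs x t\<bar> \<le> w t * (prod_list (map norm hs) * N))" for k w
  have "\<forall>k. \<exists>w. k \<le> n \<longrightarrow> dominates k w"
  proof
    fix k
    show "\<exists>w. k \<le> n \<longrightarrow> dominates k w"
    proof (cases "k \<le> n")
      case True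
      then have k: "real k < \<alpha> + 1 / \<theta>" using n by linarith
      obtain w where "integrable half_line w" "\<And>f N hs x t. H_hoelder \<alpha> N f \<Longrightarrow> length hs = k \<Longrightarrow> t > 0 \<Longrightarrow>
         \<bar>deriv_kernel lam f hs x t\<bar> \<le> w t * (prod_list (map norm hs) * N)"
        by (rule deriv_kernel_bound[OF \<alpha> k lam]) blast
      then show ?thesis unfolding dominates_def by blast
    qed blast
  qed
  from choice[OF this] obtain w where dom: "\<And>k. k \<le> n \<Longrightarrow> dominates k (w k)"
    by blast
  define K where "K k = (\<integral>t. \<bar>w k t\<bar> \<partial>half_line)" for k
  have K_nonneg: "K k \<ge> 0" for k by (simp add: K_def)
  have w_int: "integrable half_line (w k)" if "k \<le> n" for k
    using dom[OF that] by (simp add: dominates_def)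
  have w_bound: "\<bar>deriv_kernel lam f hs x t\<bar> \<le> w (length hs) t * (prod_list (map norm hs) * N)"
    if "length hs \<le> n" "H_hoelder \<alpha> N f" "t > 0" for f N hs x t
    using dom[OF that(1)] that by (simp add: dominates_def)
  obtain K' where K': "K' \<ge> 0" "\<And>f N hs x h. H_hoelder \<alpha> N f \<Longrightarrow> length hs = n \<Longrightarrow>
    (\<And>x. integrable half_line (deriv_kernel lam f hs x)) \<Longrightarrow>
    \<bar>(\<integral>t. deriv_kernel lam f hs (x + i h) t \<partial>half_line) - (\<integral>t. deriv_kernel lam f hs x t \<partial>half_line)\<bar>
      \<le> K' * N * norm h powr \<sigma> * prod_list (map norm hs)"
    using resolvent_hoelder[OF \<alpha> n lam] unfolding \<sigma> by blast
  \<comment> \<open>The criterion takes a single constant for all derivatives and for the Hoelder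
    increment, so L majorizes every \<open>K k\<close> and \<open>K'\<close>.\<close>
  define L where "L = (\<Sum>k\<le>n. K k) + K'"
  have sum_nonneg: "0 \<le> (\<Sum>k\<le>n. K k)" using K_nonneg by (intro sum_nonneg) auto
  have L: "L \<ge> 0" "K' \<le> L" using sum_nonneg K'(1) by (auto simp: L_def)
  have KL: "K k \<le> L" if "k \<le> n" for k
    using member_le_sum[of k "{..n}" K] K_nonneg that K'(1) by (simp add: L_def)
  have "mehler_resolvent T \<mu> lam f \<in> CH i (\<alpha> + 1 / \<theta>) \<and>
    CH_norm i (\<alpha> + 1 / \<theta>) (mehler_resolvent T \<mu> lam f) \<le> ennreal ((real n + 2) * L * N)"
    if f: "H_hoelder \<alpha> N f" for f N
  proof -
    let ?u = "mehler_resolvent T \<mu> lam f"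
    note N = H_hoelder_nonneg[OF f]
    have bound: "integrable half_line (\<lambda>t. w (length hs) t * (prod_list (map norm hs) * N))"
      if "length hs \<le> n" for hs :: "'h list"
      using w_int[OF that] by (intro integrable_mult_left) auto
    let ?w = "\<lambda>hs t. w (length hs) t * (prod_list (map norm hs) * N)"
    note w = H_hoelder_bcontfun[OF f] bound w_bound[OF _ f]
    have smooth: "H_smooth i n ?u"
      by (rule resolvent_derivs(1)[where w="?w"]) (blast intro: w)+
    have derivs: "H_dir_derivs i hs ?u x = (\<integral>t. deriv_kernel lam f hs x t \<partial>half_line)"
      if "length hs \<le> n" for hs x
      by (rule resolvent_derivs(2)[where w="?w" and n=n]) (blast intro: w that)+
    have int: "integrable half_line (deriv_kernel lam f hs x)" if "length hs \<le> n" for hs x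
      by (rule resolvent_derivs(3)[where w="?w" and n=n]) (blast intro: w that)+
    have derivs_bound: "\<bar>H_dir_derivs i hs ?u x\<bar> \<le> L * N * prod_list (map norm hs)" if hs: "length hs \<le> n" for hs x
    proof -
      have "\<bar>\<integral>t. deriv_kernel lam f hs x t \<partial>half_line\<bar> \<le>
          (\<integral>t. \<bar>w (length hs) t\<bar> * (prod_list (map norm hs) * N) \<partial>half_line)"
      proof (rule abs_integral_le)
        fix t assume "t \<in> space half_line"
        then have "\<bar>deriv_kernel lam f hs x t\<bar> \<le> w (length hs) t * (prod_list (map norm hs) * N)"
          using w_bound[OF hs f] by (simp add: space_half_line)
        also have "\<dots> \<le> \<bar>w (length hs) t\<bar> * (prod_list (map norm hs) * N)"
          using N by (intro mult_right_mono) auto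
        finally show "\<bar>deriv_kernel lam f hs x t\<bar> \<le> \<bar>w (length hs) t\<bar> * (prod_list (map norm hs) * N)" .
      qed (use int[OF hs] w_int[OF hs] in auto)
      also have "\<dots> = (\<integral>t. \<bar>w (length hs) t\<bar> \<partial>half_line) * (prod_list (map norm hs) * N)"
        by simp
      also have "\<dots> \<le> L * (prod_list (map norm hs) * N)"
        using KL[OF hs] N unfolding K_def by (intro mult_right_mono) auto
      finally show ?thesis using derivs[OF hs] by (simp add: mult_ac)
    qed
    have derivs_hoelder: "\<bar>H_dir_derivs i hs ?u (x + i h) - H_dir_derivs i hs ?u x\<bar>
        \<le> L * N * norm h powr \<sigma> * prod_list (map norm hs)" if hs: "length hs = n" for hs x h
    proof -
      have "\<bar>H_dir_derivs i hs ?u (x + i h) - H_dir_derivs i hs ?u x\<bar>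
          \<le> K' * N * norm h powr \<sigma> * prod_list (map norm hs)"
        using K'(2)[OF f hs] int[of hs] derivs[of hs] hs by simp
      also have "\<dots> \<le> L * N * norm h powr \<sigma> * prod_list (map norm hs)"
        using L(2) N by (intro mult_right_mono) auto
      finally show ?thesis .
    qed
    have \<sigma>_pos: "\<sigma> > 0" using n \<sigma> by simp
    note crit = smooth derivs_bound derivs_hoelder \<sigma>_pos
    have hol: "H_holder_seminorm i n \<sigma> (H_deriv i ?u n) \<le> ennreal (L * N)"
      by (rule H_criterion_holder[OF crit])
    have "?u \<in> CH i (\<alpha> + 1 / \<theta>)"
      unfolding CH_def using H_criterion_CnH[OF crit] le_less_trans[OF hol]
      by (auto simp: n_def[symmetric] \<sigma>_def[symmetric])
    moreover have "CH_norm i (\<alpha> + 1 / \<theta>) ?u \<le> ennreal (real (Suc n) * (L * N)) + ennreal (L * N)"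
      unfolding CH_norm_def n_def[symmetric] \<sigma>_def[symmetric]
      by (intro add_mono H_criterion_CnH_norm[OF crit] hol)
    moreover have "ennreal (real (Suc n) * (L * N)) + ennreal (L * N) = ennreal ((real n + 2) * L * N)"
      using L N by (subst ennreal_plus[symmetric]) (auto simp: algebra_simps)
    ultimately show ?thesis by simp
  qed
  \<comment> \<open>The factor n + 2 adds the seminorm to the n + 1 terms of the norm; the extra 1
    keeps the constant positive when L = 0.\<close>
  moreover have "ennreal ((real n + 2) * L * N) \<le> ennreal (((real n + 2) * L + 1) * N)" if "H_hoelder \<alpha> N f" for N f
    using H_hoelder_nonneg[OF that] by (intro ennreal_leI mult_right_mono) auto
  moreover have "(real n + 2) * L + 1 > 0" using L by (simp add: add_nonneg_pos)
  ultimately show ?thesis by (meson order_trans)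
qed

end

section \<open>Passing between extended norms and real bounds\<close>

lemma bcontfun_sup_norm:
  fixes f :: "'a::topological_space \<Rightarrow> real"
  assumes "f \<in> bcontfun"
  obtains N where "N \<ge> 0" "sup_norm f = ennreal N" "\<And>x. \<bar>f x\<bar> \<le> N"
proof -
  obtain B where B: "\<And>x. \<bar>f x\<bar> \<le> B" using bcontfun_bounds[OF assms] by blast
  have "sup_norm f \<le> ennreal B"
    unfolding sup_norm_def using B by (intro SUP_least ennreal_leI) auto
  then have fin: "sup_norm f < \<infinity>" by (simp add: le_less_trans)
  then have eq: "sup_norm f = ennreal (enn2real (sup_norm f))" by simp
  have "ennreal \<bar>f x\<bar> \<le> sup_norm f" for x
    unfolding sup_norm_def by (rule SUP_upper) simp
  then have "\<bar>f x\<bar> \<le> enn2real (sup_norm f)" for x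
    using fin by (metis abs_ge_zero enn2real_ennreal enn2real_mono infinity_ennreal_def)
  then show thesis using that[OF _ eq] by simp
qed

text \<open>For 0 < \<alpha> < 1 the norm is the sup norm plus the Hoelder seminorm. Their sum is
  taken as N, so that one constant serves both clauses of \<open>H_hoelder\<close>, at the cost of
  no extra factor.\<close>

lemma (in mehler_semigroup) CH_H_hoelder:
  assumes f: "f \<in> CH i \<alpha>" and \<alpha>: "0 < \<alpha>" "\<alpha> < 1"
  obtains N where "CH_norm i \<alpha> f = ennreal N" "H_hoelder \<alpha> N f"
proof -
  have fl: "nat \<lfloor>\<alpha>\<rfloor> = 0" "frac \<alpha> = \<alpha>"
    using \<alpha> by (auto simp: floor_unique frac_eq)
  define c where "c = enn2real (H_holder_seminorm i 0 \<alpha> (H_deriv i f 0))"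
  have bc: "f \<in> bcontfun" and fin: "H_holder_seminorm i 0 \<alpha> (H_deriv i f 0) < \<infinity>"
    using f by (auto simp: CH_def fl CnH_def)
  have c: "H_holder_seminorm i 0 \<alpha> (H_deriv i f 0) = ennreal c" using fin by (simp add: c_def)
  have c0: "c \<ge> 0" by (simp add: c_def)
  obtain N where N: "N \<ge> 0" "sup_norm f = ennreal N" "\<And>x. \<bar>f x\<bar> \<le> N"
    using bcontfun_sup_norm[OF bc] by blast
  have diff: "\<bar>f (x + i h) - f x\<bar> \<le> c * norm h powr \<alpha>" for x h
  proof (cases "h = 0")
    case False
    then have h: "norm h powr \<alpha> > 0" by simp
    have "multi_norm 0 (\<lambda>hs. H_deriv i f 0 (x + i h) hs - H_deriv i f 0 x hs) / ennreal (norm h powr \<alpha>)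
        \<le> ennreal c"
      unfolding c[symmetric] H_holder_seminorm_def using False
      by (intro SUP_upper2[of x] SUP_upper2[of h]) auto
    then have "ennreal (\<bar>f (x + i h) - f x\<bar> / norm h powr \<alpha>) \<le> ennreal c"
      using h by (simp add: multi_norm_0 divide_ennreal)
    then have "\<bar>f (x + i h) - f x\<bar> / norm h powr \<alpha> \<le> c"
      using c0 by simp
    then show ?thesis using h by (simp add: field_simps)
  qed simp
  have "CH_norm i \<alpha> f = ennreal (N + c)"
    unfolding CH_norm_def CnH_norm_def fl c N(2) using N(1) c0 by simp
  moreover have "H_hoelder \<alpha> (N + c) f"
    unfolding H_hoelder_def
  proof (intro conjI allI bc)
    show "\<bar>f x\<bar> \<le> N + c" for x using N(3)[of x] c0 by linarith
    have "c * norm h powr \<alpha> \<le> (N + c) * norm h powr \<alpha>" for h :: 'h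
      using N(1) by (intro mult_right_mono) auto
    then show "\<bar>f (x + i h) - f x\<bar> \<le> (N + c) * norm h powr \<alpha>" for x h
      using diff order_trans by blast
  qed
  ultimately show thesis by (rule that)
qed

theorem theorem3p8:
  fixes T :: "real \<Rightarrow> 'a::{banach, second_countable_topology} \<Rightarrow>\<^sub>L 'a"
    and \<mu> :: "real \<Rightarrow> 'a measure"
    and Ht :: "real \<Rightarrow> 'a set"
    and i :: "'h::banach \<Rightarrow>\<^sub>L 'a"
    and M C \<theta> \<omega> lam :: real
  assumes "strongly_continuous_semigroup T"
    and "mehler_measures T \<mu>"
    and "\<And>t. t > 0 \<Longrightarrow> subspace (Ht t) \<and> Ht t \<noteq> {0} \<and> (\<forall>v\<in>Ht t. fomin_differentiable (\<mu> t) v)"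
    and "inj (blinfun_apply i)"
    and "M > 0" and "C > 0" and "\<theta> > 0"
    and "\<And>t h. t > 0 \<Longrightarrow> \<exists>k. T t (i h) = i k \<and> norm k \<le> M * exp (\<omega> * t) * norm h"
    and "\<And>t h. t > 0 \<Longrightarrow> T t (i h) \<in> Ht t"
    and "\<And>t h. t > 0 \<Longrightarrow> \<exists>\<beta>. fomin_density (\<mu> t) (T t (i h)) \<beta> \<and>
           (\<integral>y. \<bar>\<beta> y\<bar> \<partial>\<mu> t) \<le> C * exp (\<omega> * t) * t powr (- \<theta>) * norm h"
    and "lam > 0"
  shows "(1 / \<theta> \<notin> \<nat> \<longrightarrow>
           (\<forall>f\<in>bcontfun. mehler_resolvent T \<mu> lam f \<in> CH i (1 / \<theta>)) \<and>
           (\<exists>K>0. \<forall>f\<in>bcontfun.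
              CH_norm i (1 / \<theta>) (mehler_resolvent T \<mu> lam f) \<le> ennreal K * sup_norm f)) \<and>
         (\<forall>\<alpha>. 0 < \<alpha> \<and> \<alpha> < 1 \<and> \<alpha> + 1 / \<theta> \<notin> \<nat> \<longrightarrow>
           (\<forall>f\<in>CH i \<alpha>. mehler_resolvent T \<mu> lam f \<in> CH i (\<alpha> + 1 / \<theta>)) \<and>
           (\<exists>K>0. \<forall>f\<in>CH i \<alpha>.
              CH_norm i (\<alpha> + 1 / \<theta>) (mehler_resolvent T \<mu> lam f) \<le> ennreal K * CH_norm i \<alpha> f))"
proof -
  interpret mehler_semigroup T \<mu> i M C \<theta> \<omega>
    by unfold_locales (use assms in auto)
  show ?thesis
  proof (intro conjI allI impI; (elim conjE)?)
    assume "1 / \<theta> \<notin> \<nat>"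
    then obtain K where K: "K > 0" "\<And>f N. H_hoelder 0 N f \<Longrightarrow>
      mehler_resolvent T \<mu> lam f \<in> CH i (1 / \<theta>) \<and>
      CH_norm i (1 / \<theta>) (mehler_resolvent T \<mu> lam f) \<le> ennreal (K * N)"
      using resolvent_regularity[of 0 lam] \<open>lam > 0\<close> by auto
    \<comment> \<open>The constant 2 K accounts for the doubling in
      \<open>H_hoelder_0\<close>.\<close>
    have main: "mehler_resolvent T \<mu> lam f \<in> CH i (1 / \<theta>) \<and>
      CH_norm i (1 / \<theta>) (mehler_resolvent T \<mu> lam f) \<le> ennreal (2 * K) * sup_norm f"
      if f: "f \<in> bcontfun" for f
    proof -
      obtain N where N: "N \<ge> 0" "sup_norm f = ennreal N" "\<And>x. \<bar>f x\<bar> \<le> N"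
        using bcontfun_sup_norm[OF f] by blast
      show ?thesis
        using K(2)[OF H_hoelder_0[OF f N(3)]] N K(1) by (simp add: ennreal_mult[symmetric] mult_ac)
    qed
    show "\<forall>f\<in>bcontfun. mehler_resolvent T \<mu> lam f \<in> CH i (1 / \<theta>)"
      using main by blast
    show "\<exists>K>0. \<forall>f\<in>bcontfun.
        CH_norm i (1 / \<theta>) (mehler_resolvent T \<mu> lam f) \<le> ennreal K * sup_norm f"
      using main K(1) by (intro exI[of _ "2 * K"]) auto
  next
    fix \<alpha> assume \<alpha>: "0 < \<alpha>" "\<alpha> < 1" "\<alpha> + 1 / \<theta> \<notin> \<nat>"
    then obtain K where K: "K > 0" "\<And>f N. H_hoelder \<alpha> N f \<Longrightarrow>
      mehler_resolvent T \<mu> lam f \<in> CH i (\<alpha> + 1 / \<theta>) \<and>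
      CH_norm i (\<alpha> + 1 / \<theta>) (mehler_resolvent T \<mu> lam f) \<le> ennreal (K * N)"
      using resolvent_regularity[of \<alpha> lam] \<open>lam > 0\<close> by auto
    have main: "mehler_resolvent T \<mu> lam f \<in> CH i (\<alpha> + 1 / \<theta>) \<and>
      CH_norm i (\<alpha> + 1 / \<theta>) (mehler_resolvent T \<mu> lam f) \<le> ennreal K * CH_norm i \<alpha> f"
      if f: "f \<in> CH i \<alpha>" for f
    proof -
      obtain N where N: "CH_norm i \<alpha> f = ennreal N" "H_hoelder \<alpha> N f"
        using CH_H_hoelder[OF f \<alpha>(1,2)] by blast
      then show ?thesis
        using K(2)[OF N(2)] K(1) H_hoelder_nonneg[OF N(2)] by (simp add: ennreal_mult)
    qed
    show "\<forall>f\<in>CH i \<alpha>. mehler_resolvent T \<mu> lam f \<in> CH i (\<alpha> + 1 / \<theta>)"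
      using main by blast
    show "\<exists>K>0. \<forall>f\<in>CH i \<alpha>.
        CH_norm i (\<alpha> + 1 / \<theta>) (mehler_resolvent T \<mu> lam f) \<le> ennreal K * CH_norm i \<alpha> f"
      using main K(1) by blast
  qed
qed

end
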